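(* Let $m>1$. Assume: (1) $\mathcal{A}$ is irreducible; (2) the noise vectors $(\varepsilon_{k,1},\ldots,\varepsilon_{k,n})^{\tau}$, $k\ge 0$, form an i.i.d. random sequence with a multivariate normal distribution $N(0,\Sigma)$. If $\|E\widetilde\Theta_{0}\|\neq 0$, then there is a sequence of data $\{\Phi_{k}\}_{k=0}^{+\infty}$, $\Phi_k=\mathrm{diag}\{\phi_{k,1},\dots,\phi_{k,n}\}$ with $\phi_{k,i}\in\mathbb{R}^m$, satisfying $$\lim_{k\rightarrow+\infty}\lambda_{\min}(P_{k,i}^{-1})=+\infty,\quad i=1,\ldots,n,$$ such that the diffusion recursive least squares algorithm run with these data satisfies: (i) for some event $D_0$ with $P(D_0)>0$, $$\sup_{k\geq 0}\|\widetilde\Theta_{k}\|=+\infty\quad\text{almost surely on } D_0;$$ (ii) for any $\varepsilon>0$, $$\limsup_{k\rightarrow+\infty}P(\|\widetilde\Theta_{k}\|>\varepsilon)>0.$$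
   Context: Model: there are $n$ nodes and an unknown deterministic parameter $\theta\in\mathbb{R}^m$. At time $k\ge 0$ node $i\in\{1,\dots,n\}$ observes $\phi_{k,i}\in\mathbb{R}^m$ and $y_{k,i}=\theta^{\tau}\phi_{k,i}+\varepsilon_{k,i}\in\mathbb{R}$, where $\varepsilon_{k,i}$ is scalar noise and $(\cdot)^\tau$ denotes transpose. $\mathcal{A}=(a_{ij})_{n\times n}$ is the nonnegative weighted adjacency matrix of a directed graph on $\{1,\dots,n\}$ with edge set $\mathcal E$: $a_{ij}>0$ if $(i,j)\in\mathcal E$ and $a_{ij}=0$ otherwise. Diffusion recursive least squares (RLS), adapt-then-combine form: with initial estimates $\theta_{0,i}\in\mathbb{R}^m$ and $P_{0,i}=I_m$, for $k\ge 0$, $$P_{k+1,i}^{-1}=I_m+\sum_{j=0}^{k}\phi_{j,i}\phi_{j,i}^{\tau},\qquad L_{k,i}=P_{k+1,i}\phi_{k,i}=\frac{P_{k,i}\phi_{k,i}}{1+\phi_{k,i}^{\tau}P_{k,i}\phi_{k,i}},$$ $$\beta_{k+1,i}=\theta_{k,i}+L_{k,i}(y_{k,i}-\theta_{k,i}^{\tau}\phi_{k,i}),\qquad \theta_{k+1,i}=\sum_{j=1}^{n}a_{ij}\beta_{k+1,j}.$$ Notation: $\widetilde\Theta_k=\mathrm{col}\{\theta_{k,1}-\theta,\dots,\theta_{k,n}-\theta\}\in\mathbb{R}^{mn}$; $\Phi_k$ is the block-diagonal $mn\times n$ matrix with diagonal blocks $\phi_{k,i}$; $\lambda_{\min}$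 is the smallest eigenvalue; $\|\cdot\|$ is the Euclidean norm.
   Formalization: The formal theorem requires n ≥ 2 nodes; for n = 1, A = (1) and Σ = 0 the error is P_k times the initial error, which stays bounded and tends to 0 under the excitation condition, so the claim fails there. *)

theory Defs
  imports "HOL-Probability.Probability"
begin

section \<open>Networks\<close>

definition weighted_adjacency :: "('n::finite \<times> 'n) set \<Rightarrow> real^'n^'n \<Rightarrow> bool" where
  "weighted_adjacency E A \<longleftrightarrow>
     (\<forall>i j. ((i, j) \<in> E \<longrightarrow> A $ i $ j > 0) \<and> ((i, j) \<notin> E \<longrightarrow> A $ i $ j = 0))"

text \<open>A matrix is reducible if a simultaneous permutation of its rows and columns brings it to
  block triangular form with two nonempty square diagonal blocks.  The index type carries no
  order, so such a permutation amounts to a split of the indices into the nonempty sets \<open>S\<close>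
  and \<open>- S\<close>, with a zero block in rows \<open>S\<close> and columns \<open>- S\<close>.
  For a \<open>1 \<times> 1\<close> matrix there is no such split.\<close>

definition reducible_matrix :: "real^'n^'n \<Rightarrow> bool" where
  "reducible_matrix A \<longleftrightarrow>
     (\<exists>S. S \<noteq> {} \<and> - S \<noteq> {} \<and> (\<forall>i\<in>S. \<forall>j\<in>- S. A $ i $ j = 0))"

abbreviation irreducible_matrix :: "real^'n^'n \<Rightarrow> bool" where
  "irreducible_matrix A \<equiv> \<not> reducible_matrix A"


section \<open>Multivariate normal random vectors\<close>

text \<open>The law \<open>N(\<mu>, v)\<close> on the line, parametrised by the variance \<open>v \<ge> 0\<close>;
  it is the point mass at \<open>\<mu>\<close> if \<open>v = 0\<close>.\<close>

definition normal_law :: "real \<Rightarrow> real \<Rightarrow> real measure" where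
  "normal_law \<mu> v =
     (if v = 0 then return borel \<mu>
      else density lborel (\<lambda>x. ennreal (normal_density \<mu> (sqrt v) x)))"

text \<open>\<open>X\<close> has law \<open>N(\<mu>, \<Sigma>)\<close> if \<open>\<Sigma>\<close> is symmetric positive semidefinite and
  every linear form \<open>c \<bullet> X\<close> has the univariate normal law with the corresponding mean and
  variance.  A singular \<open>\<Sigma>\<close> is allowed.\<close>

definition multivariate_normal ::
    "'a measure \<Rightarrow> ('a \<Rightarrow> real^'n) \<Rightarrow> real^'n \<Rightarrow> real^'n^'n \<Rightarrow> bool" where
  "multivariate_normal M X \<mu> \<Sigma> \<longleftrightarrow>
     transpose \<Sigma> = \<Sigma> \<and> (\<forall>c. c \<bullet> (\<Sigma> *v c) \<ge> 0) \<and>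
     X \<in> borel_measurable M \<and>
     (\<forall>c. distr M borel (\<lambda>\<omega>. c \<bullet> X \<omega>) = normal_law (c \<bullet> \<mu>) (c \<bullet> (\<Sigma> *v c)))"


section \<open>Smallest eigenvalue\<close>

text \<open>Only meant for real symmetric matrices, where the set below is finite and nonempty.\<close>

definition lambda_min :: "real^'m^'m \<Rightarrow> real" where
  "lambda_min B = Min {c. \<exists>v. v \<noteq> 0 \<and> B *v v = c *\<^sub>R v}"


section \<open>Diffusion recursive least squares (adapt then combine)\<close>

text \<open>The regressors are a family \<open>\<phi> k i\<close> (time \<open>k\<close>, node \<open>i\<close>), which is the same data as
  the block diagonal matrices \<open>diag{\<phi> k 1, \<dots>, \<phi> k n}\<close>.  A vector in \<open>real^'m^'n\<close> stacks
  one vector of \<open>real^'m\<close> per node; its norm is the Euclidean norm of the stacked vector.\<close>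

definition rls_Pinv :: "(nat \<Rightarrow> 'n \<Rightarrow> real^'m) \<Rightarrow> nat \<Rightarrow> 'n \<Rightarrow> real^'m^'m" where
  "rls_Pinv \<phi> k i = mat 1 +
     (\<Sum>j<k. (columnvector (\<phi> j i) :: real^1^'m) ** (rowvector (\<phi> j i) :: real^'m^1))"

definition rls_P :: "(nat \<Rightarrow> 'n \<Rightarrow> real^'m) \<Rightarrow> nat \<Rightarrow> 'n \<Rightarrow> real^'m^'m" where
  "rls_P \<phi> k i = matrix_inv (rls_Pinv \<phi> k i)"

definition rls_gain :: "(nat \<Rightarrow> 'n \<Rightarrow> real^'m) \<Rightarrow> nat \<Rightarrow> 'n \<Rightarrow> real^'m" where
  "rls_gain \<phi> k i = rls_P \<phi> (Suc k) i *v \<phi> k i"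

definition observation ::
    "real^'m \<Rightarrow> (nat \<Rightarrow> 'n \<Rightarrow> real^'m) \<Rightarrow> (nat \<Rightarrow> real^'n) \<Rightarrow> nat \<Rightarrow> 'n \<Rightarrow> real" where
  "observation \<theta> \<phi> e k i = \<theta> \<bullet> \<phi> k i + e k $ i"

definition rls_adapt ::
    "(nat \<Rightarrow> 'n \<Rightarrow> real^'m) \<Rightarrow> (nat \<Rightarrow> 'n \<Rightarrow> real) \<Rightarrow> nat \<Rightarrow> real^'m^'n \<Rightarrow> 'n \<Rightarrow> real^'m" where
  "rls_adapt \<phi> y k x i = x $ i + (y k i - (x $ i) \<bullet> \<phi> k i) *\<^sub>R rls_gain \<phi> k i"

primrec diffusion_rls ::
    "real^'n^'n \<Rightarrow> (nat \<Rightarrow> 'n \<Rightarrow> real^'m) \<Rightarrow> (nat \<Rightarrow> 'n \<Rightarrow> real) \<Rightarrow> real^'m^'n \<Rightarrow> nat \<Rightarrow> real^'m^'n" where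
  "diffusion_rls A \<phi> y x0 0 = x0"
| "diffusion_rls A \<phi> y x0 (Suc k) =
     (\<chi> i. \<Sum>j\<in>UNIV. (A $ i $ j) *\<^sub>R rls_adapt \<phi> y k (diffusion_rls A \<phi> y x0 k) j)"

definition stacked_error :: "real^'m \<Rightarrow> real^'m^'n \<Rightarrow> real^'m^'n" where
  "stacked_error \<theta> x = (\<chi> i. x $ i - \<theta>)"

text \<open>The error at time \<open>k\<close> along a noise path \<open>e\<close>, from initial estimates \<open>x0\<close>.\<close>

definition diffusion_rls_error ::
    "real^'n^'n \<Rightarrow> real^'m \<Rightarrow> (nat \<Rightarrow> 'n \<Rightarrow> real^'m) \<Rightarrow> (nat \<Rightarrow> real^'n) \<Rightarrow> real^'m^'n \<Rightarrow> nat
      \<Rightarrow> real^'m^'n" where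
  "diffusion_rls_error A \<theta> \<phi> e x0 k =
     stacked_error \<theta> (diffusion_rls A \<phi> (observation \<theta> \<phi> e) x0 k)"

end

theory Submission
  imports Defs
begin

text \<open>
  One RLS update of a node multiplies its error by \<open>P\<^bsub>k+1\<^esub> P\<^bsub>k\<^esub>\<^sup>-\<^sup>1\<close>.  For a single node these
  factors telescope, but each of them alone is close to an oblique projection, of large norm once
  \<open>P\<^bsub>k\<^esub>\<close> is ill conditioned, and the mixing of the nodes destroys the telescoping.  Concretely,
  feed \<open>\<kappa> u\<close> and then \<open>v + \<kappa> u\<close> to one node \<open>j\<close>, nothing to the others, and let the network
  idle for a while.  The first update all but removes the component along \<open>u\<close> from the error of
  \<open>j\<close>, the neighbours reintroduce it, and the second update amplifies it by a factor of order
  \<open>\<kappa>\<close> and turns it into a direction not orthogonal to \<open>v\<close>; by irreducibility, idling carries this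
  large error to the neighbours of any prescribed next node, where the same can be done with \<open>v\<close>
  in the role of \<open>u\<close>.

  The argument is pathwise: on every noise path on which the neighbours of \<open>j\<close> supply a nonzero
  component along \<open>u\<close>, the error exceeds any bound once \<open>\<kappa>\<close> is large.  Hence, if this happens with
  probability greater than \<open>p\<close>, some deterministic \<open>\<kappa>\<close> makes the error large and the next component
  nonzero with probability greater than the same \<open>p\<close>.  Each stage adds at least \<open>(v \<bullet> x)\<^sup>2 / 2\<close> to
  the quadratic form of \<open>P\<^bsub>k,j\<^esub>\<^sup>-\<^sup>1\<close>, so running cyclically through all pairs \<open>(j, v)\<close> yields the
  excitation.
\<close>

section \<open>The error recursion and the information matrix\<close>

lemma diffusion_rls_error_0: "diffusion_rls_error A \<theta> \<phi> e x0 0 = stacked_error \<theta> x0"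
  by (simp add: diffusion_rls_error_def)

lemma diffusion_rls_error_Suc:
  "diffusion_rls_error A \<theta> \<phi> e x0 (Suc k) $ i =
     (\<Sum>j\<in>UNIV. A $ i $ j *\<^sub>R (diffusion_rls_error A \<theta> \<phi> e x0 k $ j
        - (diffusion_rls_error A \<theta> \<phi> e x0 k $ j \<bullet> \<phi> k j - e k $ j) *\<^sub>R rls_gain \<phi> k j))
     + ((\<Sum>j\<in>UNIV. A $ i $ j) - 1) *\<^sub>R \<theta>"
proof -
  let ?x = "diffusion_rls A \<phi> (observation \<theta> \<phi> e) x0 k"
  have "A $ i $ j *\<^sub>R rls_adapt \<phi> (observation \<theta> \<phi> e) k ?x j =
      A $ i $ j *\<^sub>R ((?x $ j - \<theta>) - ((?x $ j - \<theta>) \<bullet> \<phi> k j - e k $ j) *\<^sub>R rls_gain \<phi> k j)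
      + A $ i $ j *\<^sub>R \<theta>" for j
    by (simp add: rls_adapt_def observation_def algebra_simps inner_diff_left)
  then show ?thesis
    by (simp add: diffusion_rls_error_def stacked_error_def sum.distrib
        flip: scaleR_sum_left) (simp add: algebra_simps)
qed

lemma rls_Pinv_mult_vec:
  fixes x :: "real^'c"
  shows "rls_Pinv \<phi> k i *v x = x + (\<Sum>j<k. (\<phi> j i \<bullet> x) *\<^sub>R \<phi> j i)"
proof -
  have "((columnvector w :: real^1^'c) ** (rowvector w :: real^'c^1)) *v x = (w \<bullet> x) *\<^sub>R w"
    for w x :: "real^'c"
    by (simp add: vec_eq_iff matrix_vector_mult_def matrix_matrix_mult_def columnvector_def
        rowvector_def inner_vec_def sum_distrib_right mult_ac sum_distrib_left)
  moreover have "sum f B *v x = (\<Sum>j\<in>B. f j *v x)" if "finite B"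
    for f :: "nat \<Rightarrow> real^'c^'c" and B and x :: "real^'c"
    using that by induction (auto simp: matrix_vector_mult_add_rdistrib)
  ultimately show ?thesis
    by (simp add: rls_Pinv_def matrix_vector_mult_add_rdistrib)
qed

lemma rls_Pinv_cong:
  assumes "\<And>j. j < k \<Longrightarrow> \<phi> j i = \<psi> j i"
  shows "rls_Pinv \<phi> k i = rls_Pinv \<psi> k i"
  using assms by (auto simp: rls_Pinv_def intro!: sum.cong)

text \<open>Causality: the state at time \<open>k\<close> has seen only earlier data. This allows
  regressors to be built stage by stage and glued together at the end.\<close>

lemma diffusion_rls_error_cong:
  assumes "\<And>j. j < k \<Longrightarrow> \<phi> j = \<psi> j"
  shows "diffusion_rls_error A \<theta> \<phi> e x0 k = diffusion_rls_error A \<theta> \<psi> e x0 k"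
  using assms
proof (induction k)
  case 0
  then show ?case by (simp add: diffusion_rls_error_0)
next
  case (Suc k)
  have "rls_gain \<phi> k j = rls_gain \<psi> k j" for j
    using Suc.prems by (simp add: rls_gain_def rls_P_def cong: rls_Pinv_cong)
  then show ?case
    using Suc by (subst vec_eq_iff) (simp add: diffusion_rls_error_Suc)
qed

lemma rls_Pinv_quadratic:
  "x \<bullet> (rls_Pinv \<phi> k i *v x) = x \<bullet> x + (\<Sum>j<k. (\<phi> j i \<bullet> x)\<^sup>2)"
  by (simp add: rls_Pinv_mult_vec inner_add_right inner_sum_right power2_eq_square inner_commute)

lemma rls_Pinv_symmetric:
  "x \<bullet> (rls_Pinv \<phi> k i *v y) = (rls_Pinv \<phi> k i *v x) \<bullet> y"
  by (simp add: rls_Pinv_mult_vec inner_add_right inner_sum_right inner_add_left inner_sum_left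
      inner_commute mult.commute)

lemma rls_Pinv_pos:
  assumes "x \<noteq> 0"
  shows "x \<bullet> (rls_Pinv \<phi> k i *v x) > 0"
  using assms by (auto simp: rls_Pinv_quadratic intro!: add_pos_nonneg sum_nonneg)

lemma invertible_rls_Pinv: "invertible (rls_Pinv \<phi> k i)"
proof -
  have "x = 0" if "rls_Pinv \<phi> k i *v x = 0" for x
    using rls_Pinv_pos[of x \<phi> k i] that by auto
  then show ?thesis
    by (simp add: invertible_left_inverse matrix_left_invertible_ker)
qed

lemma matrix_inv_inverse:
  fixes B :: "'a::semiring_1^'n^'m"
  assumes "invertible B"
  shows "B ** matrix_inv B = mat 1" "matrix_inv B ** B = mat 1"
  using someI_ex[OF assms[unfolded invertible_def]] by (simp_all add: matrix_inv_def)

lemma rls_Pinv_solvable: "\<exists>p. rls_Pinv \<phi> k i *v p = u"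
  using matrix_inv_inverse[OF invertible_rls_Pinv, of \<phi> k i]
  by (intro exI[of _ "matrix_inv (rls_Pinv \<phi> k i) *v u"]) (simp add: matrix_vector_mul_assoc)

text \<open>The gain solves a linear system with the invertible matrix
  \<open>rls_Pinv \<phi> (Suc k) i\<close>, so closed forms can be verified by substitution instead
  of inverting a matrix.\<close>

lemma rls_gain_eqI:
  assumes "rls_Pinv \<phi> k i *v g + (\<phi> k i \<bullet> g) *\<^sub>R \<phi> k i = \<phi> k i"
  shows "rls_gain \<phi> k i = g"
proof -
  have "\<phi> k i = rls_Pinv \<phi> (Suc k) i *v g"
    using assms by (simp add: rls_Pinv_mult_vec add.assoc)
  then have "rls_gain \<phi> k i = matrix_inv (rls_Pinv \<phi> (Suc k) i) *v (rls_Pinv \<phi> (Suc k) i *v g)"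
    by (simp add: rls_gain_def rls_P_def)
  also have "\<dots> = g"
    using matrix_inv_inverse[OF invertible_rls_Pinv, of \<phi> "Suc k" i]
    by (simp only: matrix_vector_mul_assoc) simp
  finally show ?thesis .
qed

lemma rls_gain_0: "\<phi> k i = 0 \<Longrightarrow> rls_gain \<phi> k i = 0"
  by (rule rls_gain_eqI) simp

section \<open>Eigenvalues of symmetric matrices\<close>

lemma symmetric_matrix_finite_eigenvalues:
  fixes B :: "real^'m^'m"
  assumes sym: "\<And>x y. x \<bullet> (B *v y) = (B *v x) \<bullet> y"
  shows "finite {c. \<exists>v. v \<noteq> 0 \<and> B *v v = c *\<^sub>R v}" (is "finite ?S")
proof -
  define ev where "ev c = (SOME v. v \<noteq> 0 \<and> B *v v = c *\<^sub>R v)" for c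
  have ev: "ev c \<noteq> 0" "B *v ev c = c *\<^sub>R ev c" if "c \<in> ?S" for c
    using someI_ex[of "\<lambda>v. v \<noteq> 0 \<and> B *v v = c *\<^sub>R v"] that unfolding ev_def by auto
  \<comment> \<open>Eigenvectors of distinct eigenvalues are orthogonal, hence independent, so the
    dimension bounds their number.\<close>
  have orth: "ev c \<bullet> ev d = 0" if "c \<in> ?S" "d \<in> ?S" "c \<noteq> d" for c d
    using sym[of "ev c" "ev d"] ev[OF that(1)] ev[OF that(2)] that(3) by auto
  have "pairwise orthogonal (ev ` ?S)"
    using orth by (auto simp: pairwise_def orthogonal_def)
  then have "independent (ev ` ?S)"
    by (rule pairwise_orthogonal_independent) (use ev in force)
  then have "finite (ev ` ?S)"
    using independent_bound by blast
  moreover have "inj_on ev ?S"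
  proof (rule inj_onI)
    fix c d assume "c \<in> ?S" "d \<in> ?S" "ev c = ev d"
    then show "c = d" using orth[of c d] ev(1)[of c] by auto
  qed
  ultimately show ?thesis
    using finite_image_iff by blast
qed

text \<open>A minimiser of the Rayleigh quotient is an eigenvector: otherwise moving against the
  residual \<open>w\<close> would lower the quotient. Together with finiteness this makes the
  \<open>Min\<close> in \<open>lambda_min\<close> meaningful.\<close>

lemma symmetric_matrix_has_eigenvalue:
  fixes B :: "real^'m^'m"
  assumes sym: "\<And>x y. x \<bullet> (B *v y) = (B *v x) \<bullet> y"
  shows "\<exists>c v. v \<noteq> 0 \<and> B *v v = c *\<^sub>R v"
proof -
  let ?S = "sphere (0 :: real^'m) 1"
  have "axis undefined 1 \<in> ?S" by (simp add: norm_axis_1)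
  then have "\<exists>v\<in>?S. \<forall>y\<in>?S. v \<bullet> (B *v v) \<le> y \<bullet> (B *v y)"
    by (intro continuous_attains_inf continuous_intros linear_continuous_on
        linear_conv_bounded_linear[THEN iffD1] matrix_vector_mul_linear) auto
  then obtain v where v: "norm v = 1" and min: "\<And>y. norm y = 1 \<Longrightarrow> v \<bullet> (B *v v) \<le> y \<bullet> (B *v y)"
    by auto
  define c where "c = v \<bullet> (B *v v)"
  have form: "c * (y \<bullet> y) \<le> y \<bullet> (B *v y)" for y
  proof (cases "y = 0")
    case False
    have "c \<le> (y /\<^sub>R norm y) \<bullet> (B *v (y /\<^sub>R norm y))"
      unfolding c_def by (rule min) (use False in simp)
    also have "\<dots> = (y \<bullet> (B *v y)) / (y \<bullet> y)"
      by (simp add: matrix_vector_mult_scaleR dot_square_norm power2_eq_square field_simps)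
    finally show ?thesis
      using False by (simp add: field_simps)
  qed simp
  define w where "w = B *v v - c *\<^sub>R v"
  have vw: "v \<bullet> w = 0"
    using v by (simp add: w_def c_def inner_diff_right dot_square_norm)
  have Bw: "v \<bullet> (B *v w) = w \<bullet> w"
    using vw unfolding sym by (simp add: w_def inner_diff_left inner_diff_right inner_commute)
  define h where "h = w \<bullet> (B *v w) - c * (w \<bullet> w)"
  have "0 \<le> - 2 * t * (w \<bullet> w) + t\<^sup>2 * h" for t
  proof -
    have "c * ((v - t *\<^sub>R w) \<bullet> (v - t *\<^sub>R w)) \<le> (v - t *\<^sub>R w) \<bullet> (B *v (v - t *\<^sub>R w))"
      by (rule form)
    moreover have "w \<bullet> (B *v v) = w \<bullet> w"
      using Bw sym by (metis inner_commute)
    ultimately show ?thesis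
      using vw Bw v
      by (simp add: h_def c_def matrix_vector_mult_diff_distrib matrix_vector_mult_scaleR
          inner_diff_left inner_diff_right inner_commute[of w v] dot_square_norm[of v]
          power2_eq_square algebra_simps)
  qed
  note quad = this
  have "w \<bullet> w = 0"
  proof (rule ccontr)
    assume "w \<bullet> w \<noteq> 0"
    then have pos: "w \<bullet> w > 0" by simp
    \<comment> \<open>Small enough that the quadratic term \<open>t\<^sup>2 * h\<close> offsets at
      most half of the linear term.\<close>
    define t where "t = (w \<bullet> w) / (\<bar>h\<bar> + 1)"
    have t: "t > 0" using pos by (simp add: t_def)
    have "t * h \<le> t * (\<bar>h\<bar> + 1)" using t by (intro mult_left_mono) auto
    also have "\<dots> = w \<bullet> w" by (simp add: t_def)
    finally have "t * (t * h) \<le> t * (w \<bullet> w)" using t by (intro mult_left_mono) auto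
    then have "- 2 * t * (w \<bullet> w) + t\<^sup>2 * h \<le> - t * (w \<bullet> w)"
      by (simp add: power2_eq_square algebra_simps)
    moreover have "t * (w \<bullet> w) > 0" using t pos by simp
    ultimately show False using quad[of t] by linarith
  qed
  then have "B *v v = c *\<^sub>R v" by (simp add: w_def)
  moreover have "v \<noteq> 0" using v by auto
  ultimately show ?thesis by blast
qed

lemma lambda_min_ge:
  fixes B :: "real^'m^'m"
  assumes sym: "\<And>x y. x \<bullet> (B *v y) = (B *v x) \<bullet> y"
    and form: "\<And>x. c * (x \<bullet> x) \<le> x \<bullet> (B *v x)"
  shows "c \<le> lambda_min B"
proof -
  have "c \<le> b" if "v \<noteq> 0" "B *v v = b *\<^sub>R v" for b v
    using form[of v] that by simp
  then show ?thesis
    unfolding lambda_min_def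
    using symmetric_matrix_finite_eigenvalues[OF sym] symmetric_matrix_has_eigenvalue[OF sym]
    by (subst Min_ge_iff) auto
qed


section \<open>Walks in the network and explicit gains\<close>

lemma irreducible_entry_pos:
  fixes A :: "real^'n^'n"
  assumes irr: "irreducible_matrix A" and nonneg: "\<And>i j. A $ i $ j \<ge> 0"
    and S: "S \<noteq> {}" "S \<noteq> UNIV"
  shows "\<exists>i\<in>S. \<exists>j\<in>-S. A $ i $ j > 0"
proof -
  have "\<not> (\<forall>i\<in>S. \<forall>j\<in>-S. A $ i $ j = 0)"
    using irr S unfolding reducible_matrix_def by auto
  then show ?thesis
    using nonneg by (metis less_eq_real_def)
qed

text \<open>Follow unit mass placed at \<open>j\<close>. If the set of nodes reached after at least
  one step were proper, irreducibility would give a positive entry from an unreached row to a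
  reached column, and that row would be reached too. So every node is reached, in particular a
  neighbour of \<open>i\<close> other than \<open>i\<close>. The sum omits \<open>i\<close> to match
  \<open>probe\<close>.\<close>

lemma irreducible_orbit_pos:
  fixes A :: "real^'n::finite^'n"
  assumes irr: "irreducible_matrix A" and nonneg: "\<And>i j. A $ i $ j \<ge> 0"
    and nodes: "CARD('n) > 1"
  shows "\<exists>t. (\<Sum>l\<in>-{i}. A $ i $ l * (((*v) A ^^ Suc t) (axis j 1)) $ l) > 0"
proof -
  define w where "w t = ((*v) A ^^ t) (axis j 1)" for t
  have w_Suc: "w (Suc t) = A *v w t" for t by (simp add: w_def)
  have w_nonneg: "w t $ i \<ge> 0" for t i
  proof (induction t arbitrary: i)
    case (Suc t)
    then show ?case
      unfolding w_Suc matrix_vector_mult_def using nonneg by (auto intro!: sum_nonneg)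
  qed (simp add: w_def axis_def)
  have w_pos: "w (Suc t) $ i > 0" if "A $ i $ l > 0" "w t $ l > 0" for t i l
  proof -
    have "0 < A $ i $ l * w t $ l" using that by simp
    also have "\<dots> \<le> (\<Sum>l\<in>UNIV. A $ i $ l * w t $ l)"
      using nonneg w_nonneg by (intro member_le_sum) auto
    finally show ?thesis by (simp add: w_Suc matrix_vector_mult_def)
  qed
  define S where "S = {i. \<exists>t. w (Suc t) $ i > 0}"
  have singleton: "{i} \<noteq> UNIV" for i :: 'n
  proof
    assume "{i} = UNIV"
    then have "CARD('n) = card {i}" by simp
    with nodes show False by simp
  qed
  obtain i0 where "A $ i0 $ j > 0"
    using irreducible_entry_pos[OF irr nonneg, of "-{j}"] singleton[of j] by auto
  then have "w (Suc 0) $ i0 > 0"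
    by (rule w_pos) (simp add: w_def axis_def)
  then have "S \<noteq> {}"
    unfolding S_def by blast
  moreover have False if "S \<noteq> UNIV"
  proof -
    have "-S \<noteq> {}" "-S \<noteq> UNIV" using that \<open>S \<noteq> {}\<close> by auto
    from irreducible_entry_pos[OF irr nonneg this]
    obtain i l where "i \<notin> S" "l \<in> S" "A $ i $ l > 0" by auto
    then show False using w_pos unfolding S_def by blast
  qed
  ultimately have S: "S = UNIV" by blast
  obtain l where l: "l \<noteq> i" "A $ i $ l > 0"
    using irreducible_entry_pos[OF irr nonneg, of "{i}"] singleton[of i] by auto
  obtain t where t: "w (Suc t) $ l > 0" using S unfolding S_def by blast
  have "0 < A $ i $ l * w (Suc t) $ l" using l t by simp
  also have "\<dots> \<le> (\<Sum>l\<in>-{i}. A $ i $ l * w (Suc t) $ l)"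
    using nonneg w_nonneg l by (intro member_le_sum) auto
  finally show ?thesis unfolding w_def by blast
qed

text \<open>The error of node \<open>j\<close> after a step, up to the contribution of \<open>j\<close> itself.  The drift in
  direction \<open>\<theta>\<close> is present because the rows of \<open>A\<close> need not sum to one.\<close>

definition probe :: "real^'n^'n \<Rightarrow> real^'m \<Rightarrow> 'n \<Rightarrow> real^'m^'n \<Rightarrow> real^'m" where
  "probe A \<theta> j x =
     (\<Sum>l\<in>-{j}. A $ j $ l *\<^sub>R x $ l) + ((\<Sum>l\<in>UNIV. A $ j $ l) - 1) *\<^sub>R \<theta>"

section \<open>One-step error formulas and closed forms of the gain\<close>

lemma diffusion_rls_error_single:
  fixes A :: "real^'n::finite^'n" and \<theta> :: "real^'m"
  assumes "\<And>l. l \<noteq> j \<Longrightarrow> \<phi> k l = 0"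
  fixes e x0
  defines "X \<equiv> diffusion_rls_error A \<theta> \<phi> e x0"
  shows "X (Suc k) $ i = (\<Sum>l\<in>-{j}. A $ i $ l *\<^sub>R X k $ l)
      + A $ i $ j *\<^sub>R (X k $ j - (X k $ j \<bullet> \<phi> k j - e k $ j) *\<^sub>R rls_gain \<phi> k j)
      + ((\<Sum>l\<in>UNIV. A $ i $ l) - 1) *\<^sub>R \<theta>"
proof -
  have "UNIV = insert j (-{j})" by auto
  then have split: "sum f UNIV = f j + sum f (-{j})" for f :: "'n \<Rightarrow> real^'m"
    by (metis finite_code sum.insert Compl_iff insertI1)
  show ?thesis
    unfolding X_def diffusion_rls_error_Suc split[where f = "\<lambda>l. A $ i $ l *\<^sub>R _ l"]
    by (auto simp: assms(1) rls_gain_0 intro!: sum.cong)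
qed

lemma diffusion_rls_error_idle:
  assumes "\<And>l. \<phi> k l = 0"
  fixes A \<theta> e x0
  defines "X \<equiv> diffusion_rls_error A \<theta> \<phi> e x0"
  shows "X (Suc k) $ i = (\<Sum>l\<in>UNIV. A $ i $ l *\<^sub>R X k $ l)
      + ((\<Sum>l\<in>UNIV. A $ i $ l) - 1) *\<^sub>R \<theta>"
  unfolding X_def diffusion_rls_error_Suc by (simp add: assms(1) rls_gain_0)

text \<open>Sherman-Morrison, with \<open>p\<close> the image of \<open>u\<close> under the inverse
  of the information matrix. As \<open>c\<close> grows, \<open>c\<close> times the gain tends to
  \<open>p\<close> divided by \<open>a\<close>, so the noiseless update approaches the oblique
  projection along \<open>p\<close> onto the complement of \<open>u\<close>.\<close>

lemma rls_gain_single: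
  assumes p: "rls_Pinv \<phi> k i *v p = u" and \<phi>: "\<phi> k i = c *\<^sub>R u" and a: "u \<bullet> p = a" "a \<ge> 0"
  shows "rls_gain \<phi> k i = (c / (1 + c\<^sup>2 * a)) *\<^sub>R p"
proof (rule rls_gain_eqI)
  define D where "D = 1 + c\<^sup>2 * a"
  have "D > 0" using a(2) by (auto simp: D_def intro!: add_pos_nonneg)
  then have "c / D + c * (c / D * a) * c = c"
    by (simp add: field_simps) (simp add: D_def power2_eq_square algebra_simps)
  then show "rls_Pinv \<phi> k i *v ((c / (1 + c\<^sup>2 * a)) *\<^sub>R p)
      + (\<phi> k i \<bullet> (c / (1 + c\<^sup>2 * a)) *\<^sub>R p) *\<^sub>R \<phi> k i = \<phi> k i"
    unfolding matrix_vector_mult_scaleR p \<phi> D_def[symmetric]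
    by (simp add: a(1) flip: scaleR_left.add)
qed

text \<open>\<open>D\<close> is the determinant of the identity plus the Gram matrix of the two
  regressors in the inner product given by \<open>P\<close> at time \<open>k\<close>; its terms of
  degree 3 and 4 in \<open>c\<close> cancel. Hence the gain stays bounded and does not vanish as
  \<open>c\<close> grows, although its regressor has size of order \<open>c\<close>.\<close>

lemma rls_gain_double:
  assumes p: "rls_Pinv \<phi> k i *v p = u" and q: "rls_Pinv \<phi> k i *v q = v"
    and ip: "u \<bullet> p = a" "u \<bullet> q = b" "v \<bullet> p = b" "v \<bullet> q = d"
    and \<phi>: "\<phi> k i = c *\<^sub>R u" "\<phi> (Suc k) i = v + c *\<^sub>R u"
    and D: "D = 1 + d + 2 * c * b + c\<^sup>2 * (2 * a + a * d - b\<^sup>2)" "D \<noteq> 0"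
  shows "rls_gain \<phi> (Suc k) i = ((c - c\<^sup>2 * b) / D) *\<^sub>R p + ((1 + c\<^sup>2 * a) / D) *\<^sub>R q"
proof (rule rls_gain_eqI)
  define g where "g = ((c - c\<^sup>2 * b) / D) *\<^sub>R p + ((1 + c\<^sup>2 * a) / D) *\<^sub>R q"
  have g: "u \<bullet> g = (c - c\<^sup>2 * b) / D * a + (1 + c\<^sup>2 * a) / D * b"
    "v \<bullet> g = (c - c\<^sup>2 * b) / D * b + (1 + c\<^sup>2 * a) / D * d"
    by (simp_all add: g_def inner_add_right ip)
  have ug: "u \<bullet> g = (c * a + b) / D"
    by (simp add: g add_divide_distrib[symmetric] algebra_simps)
  have \<phi>g: "(v + c *\<^sub>R u) \<bullet> g = 1 - (1 + c\<^sup>2 * a) / D"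
  proof -
    have "(c - c\<^sup>2 * b) * b + (1 + c\<^sup>2 * a) * d + c * (c * a + b) = D - (1 + c\<^sup>2 * a)"
      unfolding D(1) by (simp add: power2_eq_square algebra_simps)
    then have "((c - c\<^sup>2 * b) * b + (1 + c\<^sup>2 * a) * d + c * (c * a + b)) / D = 1 - (1 + c\<^sup>2 * a) / D"
      using D(2) by (simp add: diff_divide_distrib)
    moreover have "(v + c *\<^sub>R u) \<bullet> g =
        ((c - c\<^sup>2 * b) * b + (1 + c\<^sup>2 * a) * d + c * (c * a + b)) / D"
      unfolding inner_add_left inner_scaleR_left g(2) ug using D(2) by (simp add: field_simps)
    ultimately show ?thesis by simp
  qed
  have "rls_Pinv \<phi> (Suc k) i *v g = rls_Pinv \<phi> k i *v g + (c\<^sup>2 * (u \<bullet> g)) *\<^sub>R u"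
    by (simp add: rls_Pinv_mult_vec \<phi>(1) power2_eq_square)
  also have "rls_Pinv \<phi> k i *v g = ((c - c\<^sup>2 * b) / D) *\<^sub>R u + ((1 + c\<^sup>2 * a) / D) *\<^sub>R v"
    by (simp add: g_def matrix_vector_right_distrib matrix_vector_mult_scaleR p q)
  finally have 1: "rls_Pinv \<phi> (Suc k) i *v g =
      ((c - c\<^sup>2 * b) / D + c\<^sup>2 * (u \<bullet> g)) *\<^sub>R u + ((1 + c\<^sup>2 * a) / D) *\<^sub>R v"
    by (simp add: scaleR_left.add)
  have 2: "(c - c\<^sup>2 * b) / D + c\<^sup>2 * (u \<bullet> g) + c * (1 - (1 + c\<^sup>2 * a) / D) = c"
    unfolding ug using D(2) by (simp add: field_simps power2_eq_square)
  have "rls_Pinv \<phi> (Suc k) i *v g + (\<phi> (Suc k) i \<bullet> g) *\<^sub>R \<phi> (Suc k) i =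
      ((c - c\<^sup>2 * b) / D + c\<^sup>2 * (u \<bullet> g) + c * (1 - (1 + c\<^sup>2 * a) / D)) *\<^sub>R u + v"
    unfolding 1 \<phi>(2) \<phi>g by (simp add: algebra_simps)
  then show "rls_Pinv \<phi> (Suc k) i *v g + (\<phi> (Suc k) i \<bullet> g) *\<^sub>R \<phi> (Suc k) i = \<phi> (Suc k) i"
    unfolding 2 \<phi>(2) by simp
qed


section \<open>One amplification stage\<close>

text \<open>The trailing zeros are the idle phase. Its length is left open, so one sequence serves
  every number of idle steps.\<close>

definition stage_data ::
    "(nat \<Rightarrow> 'n \<Rightarrow> real^'m) \<Rightarrow> nat \<Rightarrow> 'n \<Rightarrow> real^'m \<Rightarrow> real^'m \<Rightarrow> real \<Rightarrow> nat \<Rightarrow> 'n \<Rightarrow> real^'m" where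
  "stage_data \<phi> K j u v c k l =
     (if k < K then \<phi> k l
      else if k = K \<and> l = j then c *\<^sub>R u
      else if k = Suc K \<and> l = j then v + c *\<^sub>R u
      else 0)"

text \<open>The error after the first update has a finite limit. The second update multiplies its
  component along \<open>u\<close> at node \<open>j\<close> by a factor of order \<open>n\<close>
  and points it along \<open>g\<close>; idling then applies \<open>A\<close>. Noise and drift are
  bounded along a fixed path and disappear after division by \<open>n\<close>.\<close>

lemma stage_limit:
  fixes \<phi> :: "nat \<Rightarrow> 'n::finite \<Rightarrow> real^'m" and A :: "real^'n^'n"
  assumes u: "u \<noteq> 0" and v: "v \<notin> span {u}"
  shows "\<exists>g. v \<bullet> g > 0 \<and> (\<forall>t i.
     (\<lambda>n. diffusion_rls_error A \<theta> (stage_data \<phi> K j u v (real n)) e x0 (K + 2 + t) $ i /\<^sub>R real n)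
       \<longlonglongrightarrow> (- (((*v) A ^^ Suc t) (axis j 1) $ i)
              * (u \<bullet> probe A \<theta> j (diffusion_rls_error A \<theta> \<phi> e x0 K))) *\<^sub>R g)"
proof -
  define Q where "Q = rls_Pinv \<phi> K j"
  obtain p q where p: "Q *v p = u" and q: "Q *v q = v"
    using rls_Pinv_solvable unfolding Q_def by metis
  define a b d where "a = u \<bullet> p" and "b = u \<bullet> q" and "d = v \<bullet> q"
  have vp: "v \<bullet> p = b"
    using rls_Pinv_symmetric[of p \<phi> K j q] p q by (simp add: b_def Q_def inner_commute)
  have "p \<noteq> 0" using p u by auto
  then have a: "a > 0"
    using rls_Pinv_pos[of p \<phi> K j] p by (simp add: a_def Q_def inner_commute)
  \<comment> \<open>Strict Cauchy-Schwarz for \<open>u\<close> and \<open>v\<close> in the inner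
    product of the inverse of \<open>Q\<close>; \<open>y\<close> comes from a Gram-Schmidt
    step.\<close>
  have disc: "a * d - b\<^sup>2 > 0"
  proof -
    define y where "y = a *\<^sub>R q - b *\<^sub>R p"
    have Qy: "Q *v y = a *\<^sub>R v - b *\<^sub>R u"
      by (simp add: y_def matrix_vector_mult_diff_distrib matrix_vector_mult_scaleR p q)
    have "a *\<^sub>R v - b *\<^sub>R u \<noteq> 0"
    proof
      assume "a *\<^sub>R v - b *\<^sub>R u = 0"
      then have "v = (b / a) *\<^sub>R u"
        using a by (metis divide_inverse_commute eq_iff_diff_eq_0 less_irrefl scaleR_scaleR
            vector_fraction_eq_iff)
      then have "v \<in> span {u}" by (auto simp: span_singleton)
      then show False using v by contradiction
    qed
    then have "y \<noteq> 0" using Qy by auto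
    then have "0 < y \<bullet> (Q *v y)" using rls_Pinv_pos[of y] by (simp add: Q_def)
    also have "\<dots> = a * (a * d - b\<^sup>2)"
      unfolding Qy by (simp add: y_def inner_diff_left inner_diff_right inner_commute[of p]
          inner_commute[of q] vp flip: a_def b_def d_def)
        (simp add: power2_eq_square algebra_simps)
    finally show ?thesis using a by (simp add: zero_less_mult_iff)
  qed
  \<comment> \<open>\<open>N\<close> is the leading coefficient of \<open>D\<close> in
    \<open>rls_gain_double\<close>, and \<open>g\<close> below is the limit of the second
    gain.\<close>
  define N where "N = 2 * a + a * d - b\<^sup>2"
  have N: "N > 0" using a disc by (simp add: N_def)
  define g where "g = (- b / N) *\<^sub>R p + (a / N) *\<^sub>R q"
  have "v \<bullet> g = (a * d - b\<^sup>2) / N"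
    by (simp add: g_def inner_add_right inner_diff_right vp power2_eq_square diff_divide_distrib flip: d_def)
  then have vg: "v \<bullet> g > 0" using disc N by simp

  define \<psi> where "\<psi> n = stage_data \<phi> K j u v (real n)" for n
  define X where "X n = diffusion_rls_error A \<theta> (\<psi> n) e x0" for n
  define x where "x = diffusion_rls_error A \<theta> \<phi> e x0 K"
  define f where "f i = ((\<Sum>l\<in>UNIV. A $ i $ l) - 1) *\<^sub>R \<theta>" for i
  have XK: "X n K = x" for n
    unfolding X_def x_def
    by (rule diffusion_rls_error_cong) (auto simp: \<psi>_def stage_data_def)
  have Pinv: "rls_Pinv (\<psi> n) K j = Q" for n
    unfolding Q_def by (rule rls_Pinv_cong) (auto simp: \<psi>_def stage_data_def)
  have \<psi>1: "\<psi> n K j = real n *\<^sub>R u" and \<psi>2: "\<psi> n (Suc K) j = v + real n *\<^sub>R u" for n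
    by (auto simp: \<psi>_def stage_data_def)
  have \<psi>0: "\<psi> n k l = 0" if "k \<ge> K" "l \<noteq> j \<or> k \<ge> K + 2" for n k l
    using that by (auto simp: \<psi>_def stage_data_def)

  have inv: "(\<lambda>n. 1 / real n) \<longlonglongrightarrow> 0"
    by (rule lim_1_over_n)
  have lim0: "(\<lambda>n. real n / (1 + (real n)\<^sup>2 * a)) \<longlonglongrightarrow> 0"
  proof -
    have "(\<lambda>n. (1 / real n) / (1 / real n * (1 / real n) + a)) \<longlonglongrightarrow> 0 / (0 * 0 + a)"
      using a by (intro tendsto_intros inv) auto
    moreover have "\<forall>\<^sub>F n in sequentially.
        (1 / real n) / (1 / real n * (1 / real n) + a) = real n / (1 + (real n)\<^sup>2 * a)"
      using eventually_gt_at_top[of 0]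
      by eventually_elim (simp add: divide_simps power2_eq_square, simp add: algebra_simps)
    ultimately show ?thesis
      by (auto dest: Lim_transform_eventually)
  qed
  have lim1: "(\<lambda>n. real n * (real n / (1 + (real n)\<^sup>2 * a))) \<longlonglongrightarrow> 1 / a"
  proof -
    have "(\<lambda>n. 1 / (1 / real n * (1 / real n) + a)) \<longlonglongrightarrow> 1 / (0 * 0 + a)"
      using a by (intro tendsto_intros inv) auto
    moreover have "\<forall>\<^sub>F n in sequentially.
        1 / (1 / real n * (1 / real n) + a) = real n * (real n / (1 + (real n)\<^sup>2 * a))"
      using eventually_gt_at_top[of 0]
      by eventually_elim (simp add: divide_simps power2_eq_square, simp add: algebra_simps)
    ultimately show ?thesis
      by (auto dest: Lim_transform_eventually)
  qed
  define D where "D n = 1 + d + 2 * real n * b + (real n)\<^sup>2 * N" for n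
  have D: "D n > 0" for n
  proof -
    \<comment> \<open>Completing the square in \<open>real n\<close> shows that this part of
      \<open>D n\<close> is positive for every \<open>n\<close>.\<close>
    have "a * (d + 2 * real n * b + (real n)\<^sup>2 * a) = (real n * a + b)\<^sup>2 + (a * d - b\<^sup>2)"
      by (simp add: power2_eq_square algebra_simps)
    also have "\<dots> > 0" using disc by (intro add_nonneg_pos) auto
    finally have "d + 2 * real n * b + (real n)\<^sup>2 * a > 0" using a by (simp add: zero_less_mult_iff)
    moreover have "(real n)\<^sup>2 * (a + (a * d - b\<^sup>2)) \<ge> 0" using a disc by simp
    ultimately show ?thesis
      unfolding D_def N_def by (simp add: algebra_simps)
  qed
  have limD: "(\<lambda>n. (real n * s + (real n)\<^sup>2 * y + z) / D n) \<longlonglongrightarrow> y / N" for s y z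
  proof -
    let ?r = "\<lambda>n::nat. 1 / real n"
    have "(\<lambda>n. (?r n * s + y + z * (?r n * ?r n)) / ((1 + d) * (?r n * ?r n) + 2 * b * ?r n + N))
        \<longlonglongrightarrow> (0 * s + y + z * (0 * 0)) / ((1 + d) * (0 * 0) + 2 * b * 0 + N)"
      using N by (intro tendsto_intros inv) auto
    moreover have "\<forall>\<^sub>F n in sequentially.
        (?r n * s + y + z * (?r n * ?r n)) / ((1 + d) * (?r n * ?r n) + 2 * b * ?r n + N)
        = (real n * s + (real n)\<^sup>2 * y + z) / D n"
      using eventually_gt_at_top[of 0]
    proof eventually_elim
      case (elim n)
      have "(1 + d) * (?r n * ?r n) + 2 * b * ?r n + N = D n / (real n)\<^sup>2"
        using elim by (simp add: D_def field_simps power2_eq_square)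
      moreover have "?r n * s + y + z * (?r n * ?r n) =
          (real n * s + (real n)\<^sup>2 * y + z) / (real n)\<^sup>2"
        using elim by (simp add: field_simps power2_eq_square)
      ultimately show ?case using elim by simp
    qed
    ultimately show ?thesis
      by (auto dest: Lim_transform_eventually)
  qed

  have gain1: "rls_gain (\<psi> n) K j = (real n / (1 + (real n)\<^sup>2 * a)) *\<^sub>R p" for n
    by (rule rls_gain_single[where u = u]) (use a in \<open>auto simp: Pinv p \<psi>1 a_def\<close>)
  have gain2: "rls_gain (\<psi> n) (Suc K) j =
      ((real n - (real n)\<^sup>2 * b) / D n) *\<^sub>R p + ((1 + (real n)\<^sup>2 * a) / D n) *\<^sub>R q" for n
    by (rule rls_gain_double[where u = u and v = v and d = d])
      (use D[of n] vp in \<open>auto simp: Pinv p q \<psi>1 \<psi>2 D_def N_def simp flip: a_def b_def d_def\<close>)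
  have gain2_lim: "(\<lambda>n. rls_gain (\<psi> n) (Suc K) j) \<longlonglongrightarrow> g"
    unfolding gain2 g_def
    using limD[of 1 "- b" 0] limD[of 0 a 1]
    by (intro tendsto_add tendsto_scaleR tendsto_const) (simp_all add: add.commute)

  \<comment> \<open>The limit of the error at time \<open>Suc K\<close>. At node \<open>j\<close>
    the projected own error is orthogonal to \<open>u\<close>, so only \<open>probe\<close>
    contributes to the component along \<open>u\<close>.\<close>
  define \<xi> where "\<xi> i = (\<Sum>l\<in>-{j}. A $ i $ l *\<^sub>R x $ l)
      + A $ i $ j *\<^sub>R (x $ j - ((x $ j \<bullet> u) / a) *\<^sub>R p) + f i" for i
  have lim_adapt: "(\<lambda>n. x $ j - (x $ j \<bullet> \<psi> n K j - e K $ j) *\<^sub>R rls_gain (\<psi> n) K j)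
      \<longlonglongrightarrow> x $ j - ((x $ j \<bullet> u) / a) *\<^sub>R p"
  proof -
    have "(\<lambda>n. x $ j - ((x $ j \<bullet> u) * (real n * (real n / (1 + (real n)\<^sup>2 * a)))
          - e K $ j * (real n / (1 + (real n)\<^sup>2 * a))) *\<^sub>R p)
        \<longlonglongrightarrow> x $ j - ((x $ j \<bullet> u) * (1 / a) - e K $ j * 0) *\<^sub>R p"
      by (intro tendsto_intros lim0 lim1)
    also have "(\<lambda>n. x $ j - ((x $ j \<bullet> u) * (real n * (real n / (1 + (real n)\<^sup>2 * a)))
          - e K $ j * (real n / (1 + (real n)\<^sup>2 * a))) *\<^sub>R p) =
        (\<lambda>n. x $ j - (x $ j \<bullet> \<psi> n K j - e K $ j) *\<^sub>R rls_gain (\<psi> n) K j)"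
      unfolding gain1 \<psi>1 by (simp only: inner_scaleR_right scaleR_scaleR left_diff_distrib mult_ac)
    finally show ?thesis by simp
  qed
  have lim_K1: "(\<lambda>n. X n (Suc K) $ i) \<longlonglongrightarrow> \<xi> i" for i
  proof -
    have "X n (Suc K) $ i = (\<Sum>l\<in>-{j}. A $ i $ l *\<^sub>R X n K $ l)
        + A $ i $ j *\<^sub>R (X n K $ j - (X n K $ j \<bullet> \<psi> n K j - e K $ j) *\<^sub>R rls_gain (\<psi> n) K j)
        + f i" for n
      unfolding X_def f_def by (rule diffusion_rls_error_single) (simp add: \<psi>0)
    then show ?thesis
      unfolding \<xi>_def XK by (simp only:) (intro tendsto_intros lim_adapt)
  qed
  have u\<xi>: "\<xi> j \<bullet> u = u \<bullet> probe A \<theta> j x"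
    using a by (simp add: \<xi>_def probe_def f_def inner_add_left inner_add_right inner_diff_left
        inner_commute[of p u] inner_commute[of "sum _ _" u] inner_commute[of \<theta> u] flip: a_def)
  have inv_scale: "(\<lambda>n. z n /\<^sub>R real n) \<longlonglongrightarrow> 0" if "z \<longlonglongrightarrow> y" for z :: "nat \<Rightarrow> real^'m" and y
    using tendsto_scaleR[OF inv that] by (simp add: divide_inverse)
  have lim_K2: "(\<lambda>n. X n (Suc (Suc K)) $ i /\<^sub>R real n)
      \<longlonglongrightarrow> (- A $ i $ j * (u \<bullet> probe A \<theta> j x)) *\<^sub>R g" for i
  proof -
    have X2: "X n (Suc (Suc K)) $ i = (\<Sum>l\<in>-{j}. A $ i $ l *\<^sub>R X n (Suc K) $ l)
        + A $ i $ j *\<^sub>R (X n (Suc K) $ j - (X n (Suc K) $ j \<bullet> \<psi> n (Suc K) j - e (Suc K) $ j)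
             *\<^sub>R rls_gain (\<psi> n) (Suc K) j) + f i" for n
      unfolding X_def f_def by (rule diffusion_rls_error_single) (simp add: \<psi>0)
    \<comment> \<open>After division by \<open>real n\<close> the regressor
      \<open>v + real n *\<^sub>R u\<close> tends to \<open>u\<close>, so only the component along
      \<open>u\<close>, times the limiting gain, survives.\<close>
    have "(\<lambda>n. (\<Sum>l\<in>-{j}. A $ i $ l *\<^sub>R (X n (Suc K) $ l /\<^sub>R real n))
        + A $ i $ j *\<^sub>R (X n (Suc K) $ j /\<^sub>R real n - ((X n (Suc K) $ j /\<^sub>R real n) \<bullet> v
             + X n (Suc K) $ j \<bullet> u - e (Suc K) $ j * (1 / real n)) *\<^sub>R rls_gain (\<psi> n) (Suc K) j)
        + f i /\<^sub>R real n)
      \<longlonglongrightarrow> (\<Sum>l\<in>-{j}. A $ i $ l *\<^sub>R 0)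
        + A $ i $ j *\<^sub>R (0 - (0 \<bullet> v + \<xi> j \<bullet> u - e (Suc K) $ j * 0) *\<^sub>R g) + 0"
      by (intro tendsto_intros inv inv_scale[OF lim_K1] lim_K1 gain2_lim inv_scale[OF tendsto_const])
    moreover have "\<forall>\<^sub>F n in sequentially.
        (\<Sum>l\<in>-{j}. A $ i $ l *\<^sub>R (X n (Suc K) $ l /\<^sub>R real n))
        + A $ i $ j *\<^sub>R (X n (Suc K) $ j /\<^sub>R real n - ((X n (Suc K) $ j /\<^sub>R real n) \<bullet> v
             + X n (Suc K) $ j \<bullet> u - e (Suc K) $ j * (1 / real n)) *\<^sub>R rls_gain (\<psi> n) (Suc K) j)
        + f i /\<^sub>R real n = X n (Suc (Suc K)) $ i /\<^sub>R real n"
      using eventually_gt_at_top[of 0]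
    proof eventually_elim
      case (elim n)
      have "(X n (Suc K) $ j /\<^sub>R real n) \<bullet> v + X n (Suc K) $ j \<bullet> u - e (Suc K) $ j * (1 / real n)
          = (1 / real n) * (X n (Suc K) $ j \<bullet> \<psi> n (Suc K) j - e (Suc K) $ j)"
        using elim unfolding \<psi>2 by (simp add: inner_add_right field_simps)
      then show ?case
        unfolding X2 by (simp only:)
          (simp add: scaleR_add_right scaleR_diff_right scaleR_sum_right mult_ac divide_inverse)
    qed
    ultimately have "(\<lambda>n. X n (Suc (Suc K)) $ i /\<^sub>R real n) \<longlonglongrightarrow> (\<Sum>l\<in>-{j}. A $ i $ l *\<^sub>R 0)
        + A $ i $ j *\<^sub>R (0 - (0 \<bullet> v + \<xi> j \<bullet> u - e (Suc K) $ j * 0) *\<^sub>R g) + 0"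
      by (rule Lim_transform_eventually)
    then show ?thesis
      by (simp add: u\<xi>)
  qed
  have lim: "(\<lambda>n. X n (K + 2 + t) $ i /\<^sub>R real n)
      \<longlonglongrightarrow> (- (((*v) A ^^ Suc t) (axis j 1) $ i) * (u \<bullet> probe A \<theta> j x)) *\<^sub>R g" for t i
  proof (induction t arbitrary: i)
    case 0
    show ?case using lim_K2[of i] by (simp add: matrix_vector_mult_basis column_def)
  next
    case (Suc t)
    define w where "w = ((*v) A ^^ Suc t) (axis j 1)"
    have step: "X n (K + 2 + Suc t) $ i = (\<Sum>l\<in>UNIV. A $ i $ l *\<^sub>R X n (K + 2 + t) $ l) + f i" for n
      using diffusion_rls_error_idle[of "\<psi> n" "K + 2 + t"] \<psi>0 by (simp add: X_def f_def)
    have "(\<lambda>n. (\<Sum>l\<in>UNIV. A $ i $ l *\<^sub>R (X n (K + 2 + t) $ l /\<^sub>R real n)) + f i /\<^sub>R real n)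
        \<longlonglongrightarrow> (\<Sum>l\<in>UNIV. A $ i $ l *\<^sub>R ((- (w $ l) * (u \<bullet> probe A \<theta> j x)) *\<^sub>R g)) + 0"
      by (intro tendsto_intros Suc.IH[folded w_def] inv_scale[OF tendsto_const])
    also have "(\<lambda>n. (\<Sum>l\<in>UNIV. A $ i $ l *\<^sub>R (X n (K + 2 + t) $ l /\<^sub>R real n)) + f i /\<^sub>R real n) =
        (\<lambda>n. X n (K + 2 + Suc t) $ i /\<^sub>R real n)"
      unfolding step by (simp add: scaleR_add_right scaleR_sum_right mult.commute)
    also have "(\<Sum>l\<in>UNIV. A $ i $ l *\<^sub>R ((- (w $ l) * (u \<bullet> probe A \<theta> j x)) *\<^sub>R g)) + 0 =
        (- ((A *v w) $ i) * (u \<bullet> probe A \<theta> j x)) *\<^sub>R g"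
      by (simp add: matrix_vector_mult_def sum_distrib_right sum_negf mult.assoc
          flip: scaleR_sum_left)
    finally show ?case by (simp add: w_def)
  qed
  show ?thesis
    using vg lim unfolding X_def \<psi>_def x_def by blast
qed

text \<open>Both claims are read off the leading term of \<open>stage_limit\<close>. The probed
  component at \<open>j'\<close> has a nonzero coefficient because \<open>walk\<close> is positive
  and \<open>g\<close> is not orthogonal to \<open>v\<close>, the direction to be used next.\<close>

lemma stage_eventually:
  fixes \<phi> :: "nat \<Rightarrow> 'n::finite \<Rightarrow> real^'m" and A :: "real^'n^'n"
  assumes u: "u \<noteq> 0" and v: "v \<notin> span {u}"
    and walk: "(\<Sum>l\<in>-{j'}. A $ j' $ l * (((*v) A ^^ Suc t) (axis j 1)) $ l) > 0"
    and start: "u \<bullet> probe A \<theta> j (diffusion_rls_error A \<theta> \<phi> e x0 K) \<noteq> 0"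
  shows "\<forall>\<^sub>F n in sequentially.
    v \<bullet> probe A \<theta> j' (diffusion_rls_error A \<theta> (stage_data \<phi> K j u v (real n)) e x0 (K + 2 + t)) \<noteq> 0 \<and>
    norm (diffusion_rls_error A \<theta> (stage_data \<phi> K j u v (real n)) e x0 (K + 2 + t)) > R"
proof -
  define w where "w = ((*v) A ^^ Suc t) (axis j 1)"
  define s where "s = u \<bullet> probe A \<theta> j (diffusion_rls_error A \<theta> \<phi> e x0 K)"
  define X where "X n = diffusion_rls_error A \<theta> (stage_data \<phi> K j u v (real n)) e x0 (K + 2 + t)" for n
  obtain g where g: "v \<bullet> g > 0" and lim: "\<And>i. (\<lambda>n. X n $ i /\<^sub>R real n) \<longlonglongrightarrow> (- (w $ i) * s) *\<^sub>R g"
    using stage_limit[OF u v, of A \<theta> \<phi> K j e x0] unfolding X_def w_def s_def by blast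
  let ?W = "\<Sum>l\<in>-{j'}. A $ j' $ l * w $ l"
  have W: "?W > 0" using walk by (simp add: w_def)
  have s: "s \<noteq> 0" using start by (simp add: s_def)
  have probe_lim: "(\<lambda>n. v \<bullet> probe A \<theta> j' (X n) * (1 / real n)) \<longlonglongrightarrow> - ?W * s * (v \<bullet> g)"
  proof -
    have "(\<lambda>n. v \<bullet> ((\<Sum>l\<in>-{j'}. A $ j' $ l *\<^sub>R (X n $ l /\<^sub>R real n))
          + (1 / real n) *\<^sub>R ((\<Sum>l\<in>UNIV. A $ j' $ l) - 1) *\<^sub>R \<theta>))
        \<longlonglongrightarrow> v \<bullet> ((\<Sum>l\<in>-{j'}. A $ j' $ l *\<^sub>R ((- (w $ l) * s) *\<^sub>R g))
          + 0 *\<^sub>R ((\<Sum>l\<in>UNIV. A $ j' $ l) - 1) *\<^sub>R \<theta>)"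
      by (intro tendsto_intros lim lim_1_over_n)
    also have "(\<lambda>n. v \<bullet> ((\<Sum>l\<in>-{j'}. A $ j' $ l *\<^sub>R (X n $ l /\<^sub>R real n))
          + (1 / real n) *\<^sub>R ((\<Sum>l\<in>UNIV. A $ j' $ l) - 1) *\<^sub>R \<theta>)) =
        (\<lambda>n. v \<bullet> probe A \<theta> j' (X n) * (1 / real n))"
      by (simp add: probe_def inner_add_right inner_sum_right sum_divide_distrib add_divide_distrib)
        (simp add: divide_inverse mult_ac)
    also have "v \<bullet> ((\<Sum>l\<in>-{j'}. A $ j' $ l *\<^sub>R ((- (w $ l) * s) *\<^sub>R g))
          + 0 *\<^sub>R ((\<Sum>l\<in>UNIV. A $ j' $ l) - 1) *\<^sub>R \<theta>) = - ?W * s * (v \<bullet> g)"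
      by (simp add: inner_sum_right sum_distrib_right sum_negf mult.assoc)
    finally show ?thesis .
  qed
  have "- ?W * s * (v \<bullet> g) \<noteq> 0" using W s g by auto
  from tendsto_imp_eventually_ne[OF probe_lim this]
  have ev1: "\<forall>\<^sub>F n in sequentially. v \<bullet> probe A \<theta> j' (X n) \<noteq> 0"
    by eventually_elim auto
  have "\<exists>i. w $ i \<noteq> 0"
  proof (rule ccontr)
    assume "\<not> ?thesis"
    then show False using W by simp
  qed
  then obtain i where "w $ i \<noteq> 0" ..
  moreover have "g \<noteq> 0" using g by auto
  ultimately have L: "norm ((- (w $ i) * s) *\<^sub>R g) > 0" using s by simp
  have "filterlim (\<lambda>n. norm (X n $ i /\<^sub>R real n) * real n) at_top sequentially"
    by (rule filterlim_tendsto_pos_mult_at_top[OF tendsto_norm[OF lim] L filterlim_real_sequentially])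
  then have "\<forall>\<^sub>F n in sequentially. R < norm (X n $ i /\<^sub>R real n) * real n"
    by (simp add: filterlim_at_top_dense)
  then have ev2: "\<forall>\<^sub>F n in sequentially. R < norm (X n)"
    using eventually_gt_at_top[of 0]
  proof eventually_elim
    case (elim n)
    then show ?case using Finite_Cartesian_Product.norm_nth_le[of "X n" i] by (simp add: field_simps)
  qed
  show ?thesis
    using eventually_conj[OF ev1 ev2] unfolding X_def .
qed

text \<open>The two regressors of a stage cannot both be nearly orthogonal to \<open>x\<close>
  unless \<open>v\<close> is. The bound is uniform in \<open>c\<close>, so the amplification can be
  chosen freely.\<close>

lemma stage_excitation:
  assumes "k \<ge> K + 2"
  shows "(\<Sum>r<k. (stage_data \<phi> K j u v c r j \<bullet> x)\<^sup>2) \<ge> (\<Sum>r<K. (\<phi> r j \<bullet> x)\<^sup>2) + (v \<bullet> x)\<^sup>2 / 2"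
proof -
  let ?s = "\<lambda>r. (stage_data \<phi> K j u v c r j \<bullet> x)\<^sup>2"
  define z where "z = c * (u \<bullet> x)"
  have "(v \<bullet> x)\<^sup>2 / 2 \<le> z\<^sup>2 + (v \<bullet> x + z)\<^sup>2"
    using zero_le_power2[of "v \<bullet> x + 2 * z"] by (simp add: power2_eq_square algebra_simps)
  then have "(\<Sum>r<K. (\<phi> r j \<bullet> x)\<^sup>2) + (v \<bullet> x)\<^sup>2 / 2 \<le> (\<Sum>r<K + 2. ?s r)"
    by (simp add: stage_data_def numeral_2_eq_2 z_def inner_add_left)
  also have "\<dots> \<le> (\<Sum>r<k. ?s r)"
    using assms by (intro sum_mono2) auto
  finally show ?thesis .
qed


section \<open>Choosing the amplification\<close>

text \<open>Turns an index depending on the path into a deterministic one, at no cost in the bound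
  \<open>p\<close>, since the strict inequality leaves room.\<close>

lemma (in prob_space) prob_eventually_gt:
  assumes A: "\<And>n. A n \<in> events" and B: "\<And>\<omega>. \<omega> \<in> B \<Longrightarrow> \<forall>\<^sub>F n in sequentially. \<omega> \<in> A n"
    and p: "p < prob B"
  shows "\<exists>n::nat. p < prob (A n)"
proof -
  \<comment> \<open>The events \<open>A n\<close> need not be monotone; their tail intersections
    are, which gives continuity from below.\<close>
  define C where "C N = (\<Inter>n\<in>{N..}. A n)" for N
  have C: "C N \<in> events" for N
    unfolding C_def using A by (intro sets.countable_INT') auto
  have "B \<subseteq> (\<Union>N. C N)"
    using B by (fastforce simp: C_def eventually_sequentially)
  then have "p < prob (\<Union>N. C N)"
    using p C by (intro less_le_trans[OF p] finite_measure_mono) auto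
  moreover have "(\<lambda>N. prob (C N)) \<longlonglongrightarrow> prob (\<Union>N. C N)"
    by (rule finite_Lim_measure_incseq) (use C in \<open>auto simp: incseq_def C_def\<close>)
  ultimately have "\<forall>\<^sub>F N in sequentially. p < prob (C N)"
    by (intro order_tendstoD(1))
  then obtain N where "p < prob (C N)"
    by (auto simp: eventually_sequentially)
  also have "\<dots> \<le> prob (A N)"
    using A by (intro finite_measure_mono) (auto simp: C_def)
  finally show ?thesis by blast
qed

text \<open>Reverse Fatou for events. It stands in for a Borel-Cantelli argument, as the events of
  different stages share their past.\<close>

lemma (in prob_space) prob_limsup_ge:
  assumes A: "\<And>n::nat. A n \<in> events" and p: "\<And>n. p \<le> prob (A n)"
  shows "p \<le> prob (\<Inter>N. \<Union>n\<in>{N..}. A n)"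
proof -
  have U: "(\<Union>n\<in>{N..}. A n) \<in> events" for N using A by auto
  have "(\<lambda>N. prob (\<Union>n\<in>{N..}. A n)) \<longlonglongrightarrow> prob (\<Inter>N. \<Union>n\<in>{N..}. A n)"
    by (rule finite_Lim_measure_decseq) (use U in \<open>auto simp: decseq_def intro: order_trans\<close>)
  moreover have "p \<le> prob (\<Union>n\<in>{N..}. A n)" for N
    by (rule order_trans[OF p[of N] finite_measure_mono]) (use U in auto)
  ultimately show ?thesis
    by (intro LIMSEQ_le_const) auto
qed

section \<open>Measurability of the error process\<close>

lemma borel_measurable_vec_nth_vec:
  assumes "f \<in> borel_measurable M"
  shows "(\<lambda>\<omega>. f \<omega> $ i :: 'b::real_normed_vector) \<in> borel_measurable M"
  by (rule borel_measurable_continuous_onI[THEN measurable_compose[OF assms]])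
    (intro continuous_intros)

lemma borel_measurable_diffusion_rls_error_nth:
  fixes A :: "real^'n::finite^'n" and \<theta> :: "real^'m"
  assumes "\<And>k. \<epsilon> k \<in> borel_measurable M" and "\<theta>0 \<in> borel_measurable M"
  shows "(\<lambda>\<omega>. diffusion_rls_error A \<theta> \<phi> (\<lambda>k. \<epsilon> k \<omega>) (\<theta>0 \<omega>) k $ i) \<in> borel_measurable M"
proof (induction k arbitrary: i)
  case 0
  show ?case
    unfolding diffusion_rls_error_0 stacked_error_def
    using borel_measurable_vec_nth_vec[OF assms(2)] by simp
next
  case (Suc k)
  note [measurable] = Suc.IH borel_measurable_vec_nth_vec[OF assms(1)]
  show ?case unfolding diffusion_rls_error_Suc by measurable
qed

lemma borel_measurable_norm_diffusion_rls_error: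
  fixes A :: "real^'n::finite^'n" and \<theta> :: "real^'m"
  assumes "\<And>k. \<epsilon> k \<in> borel_measurable M" and "\<theta>0 \<in> borel_measurable M"
  shows "(\<lambda>\<omega>. norm (diffusion_rls_error A \<theta> \<phi> (\<lambda>k. \<epsilon> k \<omega>) (\<theta>0 \<omega>) k)) \<in> borel_measurable M"
proof -
  note [measurable] = borel_measurable_diffusion_rls_error_nth[OF assms]
  show ?thesis unfolding norm_vec_def[where 'a = "real^'m"] L2_set_def by measurable
qed

lemma borel_measurable_probe_diffusion_rls_error:
  fixes A :: "real^'n::finite^'n" and \<theta> :: "real^'m"
  assumes "\<And>k. \<epsilon> k \<in> borel_measurable M" and "\<theta>0 \<in> borel_measurable M"
  shows "(\<lambda>\<omega>. probe A \<theta> j (diffusion_rls_error A \<theta> \<phi> (\<lambda>k. \<epsilon> k \<omega>) (\<theta>0 \<omega>) k)) \<in> borel_measurable M"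
proof -
  note [measurable] = borel_measurable_diffusion_rls_error_nth[OF assms]
  show ?thesis unfolding probe_def by measurable
qed

text \<open>The induction step of the construction. The same \<open>p\<close> appears before and
  after, so repeating the step forever loses no probability. A single \<open>n\<close> serves both
  events because it is chosen for their intersection.\<close>

lemma (in prob_space) stage_exists:
  fixes A :: "real^'n::finite^'n" and \<theta> u v :: "real^'m"
  assumes \<epsilon>: "\<And>k. \<epsilon> k \<in> borel_measurable M" and \<theta>0: "\<theta>0 \<in> borel_measurable M"
    and irr: "irreducible_matrix A" and nonneg: "\<And>i j. A $ i $ j \<ge> 0"
    and nodes: "CARD('n) > 1"
    and u: "u \<noteq> 0" and v: "v \<notin> span {u}"
  defines "X \<equiv> \<lambda>\<phi> k \<omega>. diffusion_rls_error A \<theta> \<phi> (\<lambda>k. \<epsilon> k \<omega>) (\<theta>0 \<omega>) k"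
  assumes p: "p < prob {\<omega> \<in> space M. u \<bullet> probe A \<theta> j (X \<phi> K \<omega>) \<noteq> 0}"
  shows "\<exists>K' \<psi>. K < K' \<and> (\<forall>k<K. \<psi> k = \<phi> k) \<and>
    p < prob {\<omega> \<in> space M. v \<bullet> probe A \<theta> j' (X \<psi> K' \<omega>) \<noteq> 0} \<and>
    p < prob {\<omega> \<in> space M. norm (X \<psi> K' \<omega>) > R} \<and>
    (\<forall>x. (\<Sum>k<K. (\<phi> k j \<bullet> x)\<^sup>2) + (v \<bullet> x)\<^sup>2 / 2 \<le> (\<Sum>k<K'. (\<psi> k j \<bullet> x)\<^sup>2))"
proof -
  obtain t where t: "(\<Sum>l\<in>-{j'}. A $ j' $ l * (((*v) A ^^ Suc t) (axis j 1)) $ l) > 0"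
    using irreducible_orbit_pos[OF irr nonneg nodes] by blast
  define \<psi> where "\<psi> n = stage_data \<phi> K j u v (real n)" for n
  define K' where "K' = K + 2 + t"
  have [measurable]: "(\<lambda>\<omega>. norm (X \<phi> k \<omega>)) \<in> borel_measurable M"
    "(\<lambda>\<omega>. probe A \<theta> j (X \<phi> k \<omega>)) \<in> borel_measurable M" for \<phi> k j
    unfolding X_def
    by (rule borel_measurable_norm_diffusion_rls_error[OF \<epsilon> \<theta>0]
        borel_measurable_probe_diffusion_rls_error[OF \<epsilon> \<theta>0])+
  have "\<exists>n. p < prob {\<omega> \<in> space M. v \<bullet> probe A \<theta> j' (X (\<psi> n) K' \<omega>) \<noteq> 0 \<and> norm (X (\<psi> n) K' \<omega>) > R}"
  proof (rule prob_eventually_gt[OF _ _ p])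
    fix \<omega> assume "\<omega> \<in> {\<omega> \<in> space M. u \<bullet> probe A \<theta> j (X \<phi> K \<omega>) \<noteq> 0}"
    then show "\<forall>\<^sub>F n in sequentially. \<omega> \<in>
        {\<omega> \<in> space M. v \<bullet> probe A \<theta> j' (X (\<psi> n) K' \<omega>) \<noteq> 0 \<and> norm (X (\<psi> n) K' \<omega>) > R}"
      using stage_eventually[OF u v t, of \<theta> \<phi> "\<lambda>k. \<epsilon> k \<omega>" "\<theta>0 \<omega>" K R]
      by (simp add: X_def \<psi>_def K'_def)
  qed measurable
  then obtain n where n: "p < prob {\<omega> \<in> space M.
      v \<bullet> probe A \<theta> j' (X (\<psi> n) K' \<omega>) \<noteq> 0 \<and> norm (X (\<psi> n) K' \<omega>) > R}" ..
  have "p < prob {\<omega> \<in> space M. v \<bullet> probe A \<theta> j' (X (\<psi> n) K' \<omega>) \<noteq> 0}"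
    by (rule less_le_trans[OF n]) (rule finite_measure_mono, auto)
  moreover have "p < prob {\<omega> \<in> space M. norm (X (\<psi> n) K' \<omega>) > R}"
    by (rule less_le_trans[OF n]) (rule finite_measure_mono, auto)
  moreover have "\<psi> n k = \<phi> k" if "k < K" for k
    using that by (auto simp: \<psi>_def stage_data_def)
  moreover have "(\<Sum>k<K. (\<phi> k j \<bullet> x)\<^sup>2) + (v \<bullet> x)\<^sup>2 / 2 \<le> (\<Sum>k<K'. (\<psi> n k j \<bullet> x)\<^sup>2)" for x
    unfolding \<psi>_def by (rule stage_excitation) (simp add: K'_def)
  ultimately show ?thesis
    by (intro exI[of _ K'] exI[of _ "\<psi> n"]) (simp add: K'_def)
qed

lemma (in prob_space) start_exists:
  fixes A :: "real^'n::finite^'n" and \<theta> d :: "real^'m"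
  assumes \<epsilon>: "\<And>k. \<epsilon> k \<in> borel_measurable M" and \<theta>0: "\<theta>0 \<in> borel_measurable M"
    and irr: "irreducible_matrix A" and nonneg: "\<And>i j. A $ i $ j \<ge> 0"
    and nodes: "CARD('n) > 1"
  defines "X \<equiv> \<lambda>\<phi> k \<omega>. diffusion_rls_error A \<theta> \<phi> (\<lambda>k. \<epsilon> k \<omega>) (\<theta>0 \<omega>) k"
  assumes d: "prob {\<omega> \<in> space M. d \<bullet> stacked_error \<theta> (\<theta>0 \<omega>) $ l \<noteq> 0} > 0"
  shows "\<exists>K \<phi>. prob {\<omega> \<in> space M. d \<bullet> probe A \<theta> j (X \<phi> K \<omega>) \<noteq> 0} > 0"
proof (rule ccontr)
  txt \<open>Feed \<open>c d\<close> to node \<open>l\<close> at time 0 and idle afterwards.  The values \<open>c = 0, 1, 2\<close> cannot all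
    make the probed component vanish, since this would force \<open>d\<close> to be orthogonal to the error
    of \<open>l\<close>.\<close>
  assume contra: "\<not> ?thesis"
  obtain t where t: "(\<Sum>i\<in>-{j}. A $ j $ i * (((*v) A ^^ Suc t) (axis l 1)) $ i) > 0"
    using irreducible_orbit_pos[OF irr nonneg nodes] by blast
  have [measurable]: "(\<lambda>\<omega>. probe A \<theta> j (X \<phi> k \<omega>)) \<in> borel_measurable M" for \<phi> k j
    unfolding X_def by (rule borel_measurable_probe_diffusion_rls_error[OF \<epsilon> \<theta>0])
  define \<phi> where "\<phi> c k i = (if k = 0 \<and> i = l then c *\<^sub>R d else 0)" for c :: real and k :: nat and i :: 'n
  have zero: "AE \<omega> in M. d \<bullet> probe A \<theta> j (X (\<phi> c) (Suc t) \<omega>) = 0" for c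
  proof (rule AE_I')
    have "prob {\<omega> \<in> space M. d \<bullet> probe A \<theta> j (X (\<phi> c) (Suc t) \<omega>) \<noteq> 0} = 0"
      using contra zero_less_measure_iff by blast
    then show "{\<omega> \<in> space M. d \<bullet> probe A \<theta> j (X (\<phi> c) (Suc t) \<omega>) \<noteq> 0} \<in> null_sets M"
      by (intro null_setsI) (auto simp: emeasure_eq_measure)
  qed auto
  \<comment> \<open>The multiple of \<open>d\<close> that the update at time 0 removes from the
    error of node \<open>l\<close>; the information matrix is still the identity there, so the gain
    is parallel to \<open>d\<close>.\<close>
  define h where "h c \<omega> = (d \<bullet> stacked_error \<theta> (\<theta>0 \<omega>) $ l * c - \<epsilon> 0 \<omega> $ l) * (c / (1 + c\<^sup>2 * (d \<bullet> d)))"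
    for c \<omega>
  \<comment> \<open>The run with \<open>c = 0\<close> is the reference. After time 0 all runs follow
    the same affine recursion, so their differences are propagated by \<open>A\<close>
    alone.\<close>
  have diff: "X (\<phi> c) (Suc t) \<omega> $ i = X (\<phi> 0) (Suc t) \<omega> $ i
      - (((*v) A ^^ Suc t) (axis l 1) $ i * h c \<omega>) *\<^sub>R d" for c \<omega> i t
  proof (induction t arbitrary: i)
    case 0
    have X0: "X (\<phi> c) 0 \<omega> = stacked_error \<theta> (\<theta>0 \<omega>)" for c
      by (simp add: X_def diffusion_rls_error_0)
    have gain: "rls_gain (\<phi> c) 0 l = (c / (1 + c\<^sup>2 * (d \<bullet> d))) *\<^sub>R d" for c
      by (rule rls_gain_single[where u = d]) (auto simp: \<phi>_def rls_Pinv_mult_vec)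
    have "X (\<phi> c) (Suc 0) \<omega> $ i = (\<Sum>k\<in>-{l}. A $ i $ k *\<^sub>R stacked_error \<theta> (\<theta>0 \<omega>) $ k)
        + A $ i $ l *\<^sub>R (stacked_error \<theta> (\<theta>0 \<omega>) $ l - h c \<omega> *\<^sub>R d)
        + ((\<Sum>k\<in>UNIV. A $ i $ k) - 1) *\<^sub>R \<theta>" for c
      using diffusion_rls_error_single[of l "\<phi> c" 0 A \<theta> "\<lambda>k. \<epsilon> k \<omega>" "\<theta>0 \<omega>" i] X0[of c]
      by (simp add: X_def gain h_def) (simp add: \<phi>_def inner_commute mult_ac)
    from this[of c] this[of 0] have "X (\<phi> c) (Suc 0) \<omega> $ i =
        X (\<phi> 0) (Suc 0) \<omega> $ i - (A $ i $ l * h c \<omega>) *\<^sub>R d + (A $ i $ l * h 0 \<omega>) *\<^sub>R d"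
      by (simp add: scaleR_diff_right)
    then show ?case
      by (simp add: matrix_vector_mult_basis column_def h_def[of 0])
  next
    case (Suc t)
    let ?w = "((*v) A ^^ Suc t) (axis l 1)"
    have step: "X (\<phi> c) (Suc (Suc t)) \<omega> $ i = (\<Sum>k\<in>UNIV. A $ i $ k *\<^sub>R X (\<phi> c) (Suc t) \<omega> $ k)
        + ((\<Sum>k\<in>UNIV. A $ i $ k) - 1) *\<^sub>R \<theta>" for c
      unfolding X_def by (rule diffusion_rls_error_idle) (simp add: \<phi>_def)
    have "(\<Sum>k\<in>UNIV. A $ i $ k *\<^sub>R X (\<phi> c) (Suc t) \<omega> $ k)
        = (\<Sum>k\<in>UNIV. A $ i $ k *\<^sub>R X (\<phi> 0) (Suc t) \<omega> $ k)
          - (\<Sum>k\<in>UNIV. (A $ i $ k * ?w $ k * h c \<omega>) *\<^sub>R d)"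
      unfolding Suc.IH by (simp add: scaleR_diff_right sum_subtractf mult.assoc)
    also have "(\<Sum>k\<in>UNIV. (A $ i $ k * ?w $ k * h c \<omega>) *\<^sub>R d) = ((A *v ?w) $ i * h c \<omega>) *\<^sub>R d"
      by (simp add: matrix_vector_mult_def sum_distrib_right flip: scaleR_sum_left)
    finally show ?case
      unfolding step by simp
  qed
  define W where "W = (\<Sum>i\<in>-{j}. A $ j $ i * (((*v) A ^^ Suc t) (axis l 1)) $ i)"
  have probe_diff: "d \<bullet> probe A \<theta> j (X (\<phi> c) (Suc t) \<omega>) =
      d \<bullet> probe A \<theta> j (X (\<phi> 0) (Suc t) \<omega>) - W * h c \<omega> * (d \<bullet> d)" for c \<omega>
    unfolding probe_def diff[of c] W_def
    by (simp add: inner_add_right inner_sum_right inner_diff_right right_diff_distrib sum_subtractf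
        sum_distrib_right mult.assoc del: funpow.simps)
  have "AE \<omega> in M. d \<bullet> stacked_error \<theta> (\<theta>0 \<omega>) $ l = 0"
    using zero[of 0] zero[of 1] zero[of 2]
  proof eventually_elim
    case (elim \<omega>)
    show ?case
    proof (cases "d = 0")
      case False
      have D: "1 + c\<^sup>2 * (d \<bullet> d) > 0" for c :: real
        by (intro add_pos_nonneg) auto
      have "W \<noteq> 0" using t by (simp add: W_def)
      \<comment> \<open>With \<open>s\<close> the component of the error along \<open>d\<close>,
        these say that the noise equals both \<open>s\<close> and \<open>2 * s\<close>, whence
        \<open>s = 0\<close>.\<close>
      then have "h 1 \<omega> = 0" "h 2 \<omega> = 0"
        using elim False probe_diff[of 1 \<omega>] probe_diff[of 2 \<omega>] by auto
      then show ?thesis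
        using D[of 1] D[of 2] by (auto simp: h_def)
    qed simp
  qed
  then have "prob {\<omega> \<in> space M. d \<bullet> stacked_error \<theta> (\<theta>0 \<omega>) $ l \<noteq> 0} = 0"
    by (intro prob_eq_0_AE) auto
  then show False using d by simp
qed


section \<open>Scheduling the stages\<close>

text \<open>Write \<open>r\<close> in mixed radix: the lowest digit selects the direction, the next
  one the node. Directions then change at every step and each combination recurs. The shift in
  \<open>V (Suc r)\<close> is there because stage \<open>r\<close> excites its node in the direction
  of the following stage.\<close>

lemma schedule_exists:
  assumes "CARD('m::finite) > 1"
  shows "\<exists>(J :: nat \<Rightarrow> 'n::finite) (V :: nat \<Rightarrow> 'm).
    (\<forall>r. V (Suc r) \<noteq> V r) \<and> (\<forall>i d R. \<exists>r\<ge>R. J r = i \<and> V (Suc r) = d)"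
proof -
  define m n where "m = CARD('m)" and "n = CARD('n)"
  have m: "m > 1" using assms by (simp add: m_def)
  have n: "n > 0" by (simp add: n_def)
  obtain h :: "nat \<Rightarrow> 'm" where h: "bij_betw h {0..<m} UNIV"
    using ex_bij_betw_nat_finite[of "UNIV :: 'm set"] by (auto simp: m_def)
  obtain g :: "nat \<Rightarrow> 'n" where g: "bij_betw g {0..<n} UNIV"
    using ex_bij_betw_nat_finite[of "UNIV :: 'n set"] by (auto simp: n_def)
  define V J where "V r = h (r mod m)" and "J r = g ((r div m) mod n)" for r
  have "V (Suc r) \<noteq> V r" for r
  proof
    assume "V (Suc r) = V r"
    then have "Suc r mod m = r mod m"
      using h m by (auto simp: V_def bij_betw_def dest!: inj_onD)
    then show False using m by (auto simp: mod_Suc split: if_splits)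
  qed
  moreover have "\<exists>r\<ge>R. J r = i \<and> V (Suc r) = d" for i d R
  proof -
    obtain a where a: "a < n" "i = g a" using g by (metis UNIV_I atLeastLessThan_iff bij_betw_iff_bijections)
    obtain b where b: "b < m" "d = h b" using h by (metis UNIV_I atLeastLessThan_iff bij_betw_iff_bijections)
    \<comment> \<open>The cyclic predecessor of \<open>b\<close>, since the direction is read at
      \<open>Suc r\<close>.\<close>
    define b' where "b' = (b + (m - 1)) mod m"
    define r where "r = (R * n + a) * m + b'"
    have b': "b' < m" using m by (simp add: b'_def)
    have "Suc r mod m = Suc b' mod m"
      unfolding r_def add_Suc_right[symmetric] by (rule mod_mult_self3)
    also have "\<dots> = Suc (b + (m - 1)) mod m"
      unfolding b'_def by (rule mod_Suc_eq)
    also have "\<dots> = b" using b m by simp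
    finally have "V (Suc r) = d" by (simp add: V_def b)
    moreover have "r div m = R * n + a"
      using b' by (simp add: r_def)
    then have "J r = i" using a by (simp add: J_def)
    moreover have "R \<le> r"
    proof -
      have "R * 1 * 1 \<le> R * n * m" using n m by (intro mult_le_mono) auto
      then show ?thesis unfolding r_def distrib_right by linarith
    qed
    ultimately show ?thesis by blast
  qed
  ultimately show ?thesis by blast
qed

lemma axis_notin_span_axis:
  assumes "d \<noteq> d'"
  shows "(axis d 1 :: real^'m) \<notin> span {axis d' 1}"
proof
  assume "(axis d 1 :: real^'m) \<in> span {axis d' 1}"
  then obtain c where "(axis d 1 :: real^'m) = c *\<^sub>R axis d' 1"
    by (auto simp: span_singleton)
  then have "(axis d 1 :: real^'m) $ d = (c *\<^sub>R axis d' 1) $ d" by simp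
  then show False using assms by (simp add: axis_def)
qed

text \<open>Increments that start arbitrarily late can be taken over disjoint time intervals, so
  they add up to any multiple of each squared coordinate; summing over the coordinates bounds the
  quadratic form from below.\<close>

lemma filterlim_lambda_min_rls_Pinv:
  fixes \<phi> :: "nat \<Rightarrow> 'n \<Rightarrow> real^'m"
  assumes "\<And>d R. \<exists>K\<ge>R. \<exists>K'. \<forall>x. (\<Sum>k<K. (\<phi> k i \<bullet> x)\<^sup>2) + (x $ d)\<^sup>2 / 2 \<le> (\<Sum>k<K'. (\<phi> k i \<bullet> x)\<^sup>2)"
  shows "filterlim (\<lambda>k. lambda_min (rls_Pinv \<phi> k i)) at_top sequentially"
proof -
  define S where "S k x = (\<Sum>k<k. (\<phi> k i \<bullet> x)\<^sup>2)" for k x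
  have S_mono: "S k x \<le> S k' x" if "k \<le> k'" for k k' x
    unfolding S_def using that by (intro sum_mono2) auto
  have grow: "\<exists>k. \<forall>x. real N * ((x $ d)\<^sup>2 / 2) \<le> S k x" for N d
  proof (induction N)
    case 0
    show ?case by (auto simp: S_def intro!: sum_nonneg)
  next
    case (Suc N)
    then obtain k where k: "\<And>x. real N * ((x $ d)\<^sup>2 / 2) \<le> S k x" by blast
    obtain K K' where K: "k \<le> K" "\<And>x. S K x + (x $ d)\<^sup>2 / 2 \<le> S K' x"
      using assms[of k d] unfolding S_def by blast
    have "real (Suc N) * ((x $ d)\<^sup>2 / 2) \<le> S K' x" for x
      using k[of x] S_mono[OF K(1), of x] K(2)[of x] by (simp add: algebra_simps)
    then show ?case by blast
  qed
  show ?thesis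
    unfolding filterlim_at_top
  proof
    fix c :: real
    obtain c' :: nat where c': "c \<le> real c'" using real_arch_simple by blast
    \<comment> \<open>The 2 cancels the halving in the increments; \<open>CARD('m)\<close> pays for
      using the same sum \<open>S k' x\<close> once per coordinate.\<close>
    define N where "N = 2 * CARD('m) * c'"
    obtain k where k: "\<And>d x. real N * ((x $ d)\<^sup>2 / 2) \<le> S (k d) x"
      using grow[of N] by metis
    define k0 where "k0 = Max (range k)"
    have "c \<le> lambda_min (rls_Pinv \<phi> k' i)" if "k' \<ge> k0" for k'
    proof (rule lambda_min_ge[OF rls_Pinv_symmetric])
      fix x :: "real^'m"
      have "real N * ((x $ d)\<^sup>2 / 2) \<le> S k' x" for d
      proof -
        have "k d \<le> k'" using that by (auto simp: k0_def)
        then show ?thesis using k[of x d] S_mono by (meson order_trans)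
      qed
      then have "(\<Sum>d\<in>UNIV. real N * ((x $ d)\<^sup>2 / 2)) \<le> (\<Sum>d\<in>(UNIV :: 'm set). S k' x)"
        by (intro sum_mono)
      also have "(\<Sum>d\<in>UNIV. real N * ((x $ d)\<^sup>2 / 2)) = real CARD('m) * (real c' * (x \<bullet> x))"
        by (simp add: N_def inner_vec_def power2_eq_square sum_distrib_left mult_ac)
      finally have "real c' * (x \<bullet> x) \<le> S k' x"
        by simp
      moreover have "c * (x \<bullet> x) \<le> real c' * (x \<bullet> x)"
        using c' by (intro mult_right_mono) auto
      ultimately show "c * (x \<bullet> x) \<le> x \<bullet> (rls_Pinv \<phi> k' i *v x)"
        using inner_ge_zero[of x] unfolding rls_Pinv_quadratic S_def[symmetric] by linarith
    qed
    then show "\<forall>\<^sub>F k in sequentially. c \<le> lambda_min (rls_Pinv \<phi> k i)"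
      by (auto simp: eventually_sequentially)
  qed
qed

theorem theorem2p4:
  fixes M :: "'a measure"
    and E :: "('n::finite \<times> 'n) set"
    and A :: "real^'n^'n"
    and \<Sigma> :: "real^'n^'n"
    and \<theta> :: "real^'m"
    and \<epsilon> :: "nat \<Rightarrow> 'a \<Rightarrow> real^'n"
    and \<theta>0 :: "'a \<Rightarrow> real^'m^'n"
  assumes prob: "prob_space M"
    and dim: "CARD('m) > 1"
    and nodes: "CARD('n) > 1"
    and adjacency: "weighted_adjacency E A"
    and irreducible: "irreducible_matrix A"
    and noise_indep: "prob_space.indep_vars M (\<lambda>_. borel) \<epsilon> UNIV"
    and noise_normal: "\<And>k. multivariate_normal M (\<epsilon> k) 0 \<Sigma>"
    and init_integrable: "integrable M \<theta>0"
    and init_error: "norm (integral\<^sup>L M (\<lambda>\<omega>. stacked_error \<theta> (\<theta>0 \<omega>))) \<noteq> 0"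
  shows "\<exists>\<phi> :: nat \<Rightarrow> 'n \<Rightarrow> real^'m.
      (\<forall>i. filterlim (\<lambda>k. lambda_min (rls_Pinv \<phi> k i)) at_top sequentially) \<and>
      (\<exists>D0 \<in> sets M. measure M D0 > 0 \<and>
         (AE \<omega> in M. \<omega> \<in> D0 \<longrightarrow>
            (SUP k. ereal (norm (diffusion_rls_error A \<theta> \<phi> (\<lambda>k. \<epsilon> k \<omega>) (\<theta>0 \<omega>) k))) = \<infinity>)) \<and>
      (\<forall>e>0. limsup (\<lambda>k. ereal (measure M
           {\<omega> \<in> space M. norm (diffusion_rls_error A \<theta> \<phi> (\<lambda>k. \<epsilon> k \<omega>) (\<theta>0 \<omega>) k) > e})) > 0)"
proof -
  interpret prob_space M by (rule prob)
  have \<epsilon>: "\<epsilon> k \<in> borel_measurable M" for k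
    using noise_normal by (simp add: multivariate_normal_def)
  have \<theta>0: "\<theta>0 \<in> borel_measurable M"
    using init_integrable by (rule borel_measurable_integrable)
  have nonneg: "A $ i $ j \<ge> 0" for i j
    using adjacency unfolding weighted_adjacency_def by (metis less_eq_real_def)
  define X where "X = (\<lambda>\<phi> k \<omega>. diffusion_rls_error A \<theta> \<phi> (\<lambda>k. \<epsilon> k \<omega>) (\<theta>0 \<omega>) k)"
  have [measurable]: "(\<lambda>\<omega>. norm (X \<phi> k \<omega>)) \<in> borel_measurable M" for \<phi> k
    unfolding X_def by (rule borel_measurable_norm_diffusion_rls_error[OF \<epsilon> \<theta>0])

  obtain J :: "nat \<Rightarrow> 'n" and V :: "nat \<Rightarrow> 'm"
    where V: "\<And>r. V (Suc r) \<noteq> V r" and JV: "\<And>i d R. \<exists>r\<ge>R. J r = i \<and> V (Suc r) = d"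
    using schedule_exists[OF dim] by metis

  \<comment> \<open>A nonzero mean error forces some coordinate of the initial error to be nonzero
    with positive probability.\<close>
  obtain l d where ld: "prob {\<omega> \<in> space M. axis d 1 \<bullet> stacked_error \<theta> (\<theta>0 \<omega>) $ l \<noteq> 0} > 0"
  proof (rule ccontr)
    assume "\<not> thesis"
    then have "prob {\<omega> \<in> space M. axis d 1 \<bullet> stacked_error \<theta> (\<theta>0 \<omega>) $ l \<noteq> 0} = 0" for l d
      using that zero_less_measure_iff by blast
    moreover have [measurable]: "(\<lambda>\<omega>. stacked_error \<theta> (\<theta>0 \<omega>) $ l) \<in> borel_measurable M" for l
      unfolding stacked_error_def using borel_measurable_vec_nth_vec[OF \<theta>0] by simp
    ultimately have "AE \<omega> in M. stacked_error \<theta> (\<theta>0 \<omega>) $ l $ d = 0" for l d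
      by (intro AE_I[where N = "{\<omega> \<in> space M. axis d 1 \<bullet> stacked_error \<theta> (\<theta>0 \<omega>) $ l \<noteq> 0}"])
        (auto simp: emeasure_eq_measure inner_axis')
    then have "AE \<omega> in M. \<forall>l\<in>UNIV. \<forall>d\<in>UNIV. stacked_error \<theta> (\<theta>0 \<omega>) $ l $ d = 0"
      by (intro AE_finite_allI) auto
    then have "AE \<omega> in M. stacked_error \<theta> (\<theta>0 \<omega>) = 0"
      by eventually_elim (simp add: vec_eq_iff)
    then have "integral\<^sup>L M (\<lambda>\<omega>. stacked_error \<theta> (\<theta>0 \<omega>)) = 0"
      by (rule integral_eq_zero_AE)
    then show False using init_error by simp
  qed
  \<comment> \<open>The schedule is shifted to begin with the direction \<open>d\<close>, the one
    for which a nonzero start is available.\<close>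
  obtain r0 where r0: "V r0 = d" using JV by metis
  define u j where "u r = (axis (V (r0 + r)) 1 :: real^'m)" and "j r = J (r0 + r)" for r
  have u: "u r \<noteq> 0" "u (Suc r) \<notin> span {u r}" for r
    using axis_notin_span_axis[OF V[of "r0 + r"]] by (simp_all add: u_def axis_eq_0_iff)

  obtain K0 \<phi>0 where start: "prob {\<omega> \<in> space M. u 0 \<bullet> probe A \<theta> (j 0) (X \<phi>0 K0 \<omega>) \<noteq> 0} > 0"
    using start_exists[where \<epsilon> = \<epsilon>, OF \<epsilon> \<theta>0 irreducible nonneg nodes ld, of "j 0"] r0
    unfolding X_def u_def by auto
  \<comment> \<open>Fixed once for all stages; it becomes the lower bound for both the event
    \<open>D0\<close> and the upper limit.\<close>
  obtain p where p: "0 < p" "p < prob {\<omega> \<in> space M. u 0 \<bullet> probe A \<theta> (j 0) (X \<phi>0 K0 \<omega>) \<noteq> 0}"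
    using dense[OF start] by blast

  \<comment> \<open>The states are pairs of a time and a data sequence that matters only before that
    time. The bound \<open>r \<le> K\<close> makes the stage times unbounded.\<close>
  define live where "live r = (\<lambda>(K, \<phi>). r \<le> K \<and>
    p < prob {\<omega> \<in> space M. u r \<bullet> probe A \<theta> (j r) (X \<phi> K \<omega>) \<noteq> 0})" for r
  define step where "step r = (\<lambda>(K, \<phi>) (K', \<psi>). K < K' \<and> (\<forall>k<K. \<psi> k = \<phi> k) \<and>
    p < prob {\<omega> \<in> space M. norm (X \<psi> K' \<omega>) > real r} \<and>
    (\<forall>x. (\<Sum>k<K. (\<phi> k (j r) \<bullet> x)\<^sup>2) + (u (Suc r) \<bullet> x)\<^sup>2 / 2 \<le> (\<Sum>k<K'. (\<psi> k (j r) \<bullet> x)\<^sup>2)))" for r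
  have "\<exists>s. live 0 s"
    using p(2) by (intro exI[of _ "(K0, \<phi>0)"]) (simp add: live_def)
  moreover have "\<exists>s'. live (Suc r) s' \<and> step r s s'" if "live r s" for r s
  proof -
    obtain K \<phi> where s: "s = (K, \<phi>)" by fastforce
    have K: "r \<le> K" "p < prob {\<omega> \<in> space M. u r \<bullet> probe A \<theta> (j r) (X \<phi> K \<omega>) \<noteq> 0}"
      using that by (simp_all add: live_def s)
    obtain K' \<psi> where "K < K'" "\<forall>k<K. \<psi> k = \<phi> k"
      "p < prob {\<omega> \<in> space M. u (Suc r) \<bullet> probe A \<theta> (j (Suc r)) (X \<psi> K' \<omega>) \<noteq> 0}"
      "p < prob {\<omega> \<in> space M. norm (X \<psi> K' \<omega>) > real r}"
      "\<forall>x. (\<Sum>k<K. (\<phi> k (j r) \<bullet> x)\<^sup>2) + (u (Suc r) \<bullet> x)\<^sup>2 / 2 \<le> (\<Sum>k<K'. (\<psi> k (j r) \<bullet> x)\<^sup>2)"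
      using stage_exists[where \<epsilon> = \<epsilon>, OF \<epsilon> \<theta>0 irreducible nonneg nodes u K(2)[unfolded X_def],
          of "j (Suc r)" "real r"] unfolding X_def by blast
    then show ?thesis
      using K(1) by (intro exI[of _ "(K', \<psi>)"]) (auto simp: live_def step_def s)
  qed
  ultimately obtain s where s: "\<And>r. live r (s r)" "\<And>r. step r (s r) (s (Suc r))"
    using dependent_nat_choice[of live step] by blast
  define K \<psi> where "K r = fst (s r)" and "\<psi> r = snd (s r)" for r
  have s_eq: "s r = (K r, \<psi> r)" for r by (simp add: K_def \<psi>_def)
  have K_ge: "r \<le> K r" for r
    using s(1)[of r] by (simp add: live_def s_eq)
  have K_less: "K r < K (Suc r)" and \<psi>_Suc: "k < K r \<Longrightarrow> \<psi> (Suc r) k = \<psi> r k"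
    and large: "p < prob {\<omega> \<in> space M. norm (X (\<psi> (Suc r)) (K (Suc r)) \<omega>) > real r}"
    and excite: "(\<Sum>k<K r. (\<psi> r k (j r) \<bullet> x)\<^sup>2) + (u (Suc r) \<bullet> x)\<^sup>2 / 2
        \<le> (\<Sum>k<K (Suc r). (\<psi> (Suc r) k (j r) \<bullet> x)\<^sup>2)" for r k x
    using s(2)[of r] by (auto simp: step_def s_eq)
  have K_mono: "K r \<le> K r'" if "r \<le> r'" for r r'
    by (rule lift_Suc_mono_le[of K, OF less_imp_le[OF K_less] that])
  have \<psi>_stable: "\<psi> r' k = \<psi> r k" if "r \<le> r'" "k < K r" for r r' k
    using that(1)
  proof (induction r' rule: dec_induct)
    case (step n)
    then show ?case using \<psi>_Suc[of k n] that(2) K_mono[of r n] by simp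
  qed simp
  \<comment> \<open>Diagonal choice: \<open>K (Suc k) \<ge> Suc k > k\<close>, so the data at time
    \<open>k\<close> are settled by stage \<open>Suc k\<close>.\<close>
  define \<Phi> where "\<Phi> k = \<psi> (Suc k) k" for k
  have \<Phi>: "\<Phi> k = \<psi> r k" if "k < K r" for k r
  proof (cases "r \<le> Suc k")
    case True
    then show ?thesis unfolding \<Phi>_def using \<psi>_stable that by blast
  next
    case False
    then show ?thesis unfolding \<Phi>_def using \<psi>_stable[of "Suc k" r k] K_ge[of "Suc k"] by simp
  qed
  have X\<Phi>: "X \<Phi> (K r) = X (\<psi> r) (K r)" for r
    unfolding X_def using \<Phi> by (intro ext diffusion_rls_error_cong) simp

  have "filterlim (\<lambda>k. lambda_min (rls_Pinv \<Phi> k i)) at_top sequentially" for i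
  proof (rule filterlim_lambda_min_rls_Pinv)
    fix d R
    obtain r where r: "r \<ge> r0 + R" "J r = i" "V (Suc r) = d" using JV by blast
    define q where "q = r - r0"
    have q: "R \<le> q" "j q = i" "u (Suc q) = axis d 1"
      using r by (simp_all add: q_def j_def u_def Suc_diff_le)
    have "(\<Sum>k<K q. (\<Phi> k i \<bullet> x)\<^sup>2) + (x $ d)\<^sup>2 / 2 \<le> (\<Sum>k<K (Suc q). (\<Phi> k i \<bullet> x)\<^sup>2)" for x
      using excite[of q x] q \<Phi>[of _ q] \<Phi>[of _ "Suc q"] by (simp add: inner_axis')
    then show "\<exists>K\<ge>R. \<exists>K'. \<forall>x. (\<Sum>k<K. (\<Phi> k i \<bullet> x)\<^sup>2) + (x $ d)\<^sup>2 / 2 \<le> (\<Sum>k<K'. (\<Phi> k i \<bullet> x)\<^sup>2)"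
      using q(1) K_ge[of q] by (meson order_trans)
  qed
  moreover have "\<exists>D0 \<in> sets M. measure M D0 > 0 \<and>
      (AE \<omega> in M. \<omega> \<in> D0 \<longrightarrow> (SUP k. ereal (norm (X \<Phi> k \<omega>))) = \<infinity>)"
  proof -
    define B where "B r = {\<omega> \<in> space M. norm (X \<Phi> (K (Suc r)) \<omega>) > real r}" for r
    \<comment> \<open>On \<open>D0\<close> the error exceeds \<open>real r\<close> for infinitely
      many \<open>r\<close>, so its supremum is infinite at every point of
      \<open>D0\<close>.\<close>
    define D0 where "D0 = (\<Inter>N. \<Union>r\<in>{N..}. B r)"
    have B: "B r \<in> events" for r unfolding B_def by measurable
    have "p \<le> prob D0"
      unfolding D0_def
      by (rule prob_limsup_ge[OF B]) (use large in \<open>simp add: B_def X\<Phi> less_imp_le\<close>)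
    moreover have "D0 \<in> events" unfolding D0_def using B by auto
    moreover have "(SUP k. ereal (norm (X \<Phi> k \<omega>))) = \<infinity>" if "\<omega> \<in> D0" for \<omega>
    proof (rule SUP_PInfty)
      fix N :: nat
      have "\<omega> \<in> (\<Union>r\<in>{N..}. B r)" using that unfolding D0_def by blast
      then obtain r where "N \<le> r" "\<omega> \<in> B r" by auto
      then show "\<exists>k\<in>UNIV. ereal (real N) \<le> ereal (norm (X \<Phi> k \<omega>))"
        by (intro bexI[of _ "K (Suc r)"]) (auto simp: B_def)
    qed
    ultimately show ?thesis using p(1) by (intro bexI[of _ D0]) auto
  qed
  moreover have "limsup (\<lambda>k. ereal (prob {\<omega> \<in> space M. norm (X \<Phi> k \<omega>) > e})) > 0" for e
  proof -
    let ?f = "\<lambda>k. ereal (prob {\<omega> \<in> space M. norm (X \<Phi> k \<omega>) > e})"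
    \<comment> \<open>Along the times \<open>K (Suc r)\<close> with \<open>r\<close> at least
      \<open>e\<close>, the probabilities stay above \<open>p\<close>.\<close>
    have "ereal p \<le> limsup ?f"
    proof (rule ccontr)
      assume "\<not> ?thesis"
      then have "\<forall>\<^sub>F k in sequentially. ?f k < ereal p"
        by (intro Limsup_lessD) auto
      then obtain N where N: "\<And>k. k \<ge> N \<Longrightarrow> ?f k < ereal p"
        by (auto simp: eventually_sequentially)
      obtain r where r: "e \<le> real r" "N \<le> r"
        by (metis real_arch_simple linear order_trans of_nat_mono)
      have "p < prob {\<omega> \<in> space M. norm (X \<Phi> (K (Suc r)) \<omega>) > real r}"
        using large X\<Phi> by simp
      also have "\<dots> \<le> prob {\<omega> \<in> space M. norm (X \<Phi> (K (Suc r)) \<omega>) > e}"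
        using r by (intro finite_measure_mono) auto
      finally show False
        using N[of "K (Suc r)"] K_ge[of "Suc r"] r by simp
    qed
    moreover have "0 < ereal p" using p(1) by simp
    ultimately show ?thesis by (rule less_le_trans[rotated])
  qed
  ultimately show ?thesis
    unfolding X_def by blast
qed

end
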